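(* Let $p_1>3$ be a prime with $p_1\equiv 3\pmod 4$, let $m\ge 1$ be an integer and $N=p_1^m$. Let $p$ be a prime with $\gcd(N,p)=1$ such that $f:=\mathrm{ord}_N(p)=\phi(N)/2$, and let $q=p^f$. Let $\gamma$ be a fixed primitive element of the finite field $\mathbb{F}_q$, let $C_0=\langle\gamma^N\rangle$ be the subgroup of $\mathbb{F}_q^*$ of index $N$, let $C_i=\gamma^iC_0$ for $0\le i\le N-1$, and put $$D=\bigcup_{i=0}^{p_1^{m-1}-1}C_i .$$ Let $\chi$ be the multiplicative character of $\mathbb{F}_q$ of order $N$ defined by $\chi(\gamma)=\exp(2\pi \sqrt{-1}/N)$. Let $h$ be the class number of $\mathbb{Q}(\sqrt{-p_1})$, let $h_0=\frac{f-h}{2}$, and let $b,c$ be the integers such that $$g(\bar\chi)=\frac{b+c\sqrt{-p_1}}{2}\,p^{h_0},$$ where $b,c\not\equiv 0\pmod p$, $b^2+p_1c^2=4p^h$ and $bp^{h_0}\equiv -2\pmod{p_1}$. Then $\mathrm{Cay}(\mathbb{F}_q,D)$ is a strongly regular graph if and only if $b,c\in\{1,-1\}$.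
   Context: $\phi$ is Euler's totient function and $\mathrm{ord}_N(p)$ is the multiplicative order of $p$ modulo $N$. All graphs are simple and undirected. For $D\subset\mathbb{F}_q$ with $-D=D$ and $0\notin D$ (which holds for the set $D$ in the claim, since $-C_i=C_i$ for all $i$), $\mathrm{Cay}(\mathbb{F}_q,D)$ is the graph with vertex set $\mathbb{F}_q$ in which two vertices are adjacent if and only if their difference belongs to $D$. A strongly regular graph with parameters $(v,k,\lambda,\mu)$ is a graph with $v$ vertices, not complete or edgeless, that is regular of valency $k$, in which any two adjacent vertices have exactly $\lambda$ common neighbours and any two distinct nonadjacent vertices have exactly $\mu$ common neighbours; a graph is strongly regular if it is so for some such parameters. Gauss sums: let $\xi_p$ be a fixed complex primitive $p$-th root of unity and $\psi(x)=\xi_p^{\mathrm{Tr}_{q/p}(x)}$ for $x\in\mathbb{F}_q$, where $\mathrm{Tr}_{q/p}$ is the trace from $\mathbb{F}_q$ to $\mathbb{Z}/p\mathbb{Z}$. For a multiplicative character $\chi$ of $\mathbb{F}_q^*$, $g(\chi)=\sum_{a\in\mathbb{F}_q^*}\chi(a)\psi(a)$, and $\bar\chi=\chi^{-1}$. The existence of integers $b,c$ with the listed properties is a theorem of Langevin: if $N=p_1^m$ with $m\ge 1$ an integer and $p_1>3$ a prime congruent to $3$ modulo $4$, if $p$ is a prime with $\gcd(N,p)=1$ and $f:=\mathrm{ord}_N(p)=\phi(N)/2$ (that is, the subgroup $\langle p\rangle$ generated by $p$ has index $2$ in $(\mathbb{Z}/N\mathbb{Z})^*$), if $q=p^f$,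 and if $h$ is the class number of $\mathbb{Q}(\sqrt{-p_1})$, then for any multiplicative character $\chi$ of order $N$ of $\mathbb{F}_q$, the Gauss sum $g(\chi)$ is determined up to complex conjugation by $g(\chi)=\frac{b+c\sqrt{-p_1}}{2}p^{h_0}$ with $h_0=\frac{f-h}{2}$, $b,c\not\equiv0\pmod p$, $b^2+p_1c^2=4p^h$, $bp^{h_0}\equiv-2\pmod{p_1}$. *)

theory Defs
  imports
    Complex_Main
    "HOL-Library.Cardinality"
    "HOL-Computational_Algebra.Computational_Algebra"
    "HOL-Number_Theory.Number_Theory"
    "HOL-Algebra.Ideal"
    "Graph_Theory.Pair_Digraph"
begin

section \<open>Class number of a number field\<close>

definition quadratic_field :: "int \<Rightarrow> complex set" where
  "quadratic_field d = {of_rat r + of_rat s * csqrt (of_int d) | r s. True}"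

definition ring_of_integers :: "complex set \<Rightarrow> complex ring" where
  "ring_of_integers K =
     \<lparr>carrier = {z \<in> K. algebraic_int z}, monoid.mult = (*), one = 1, zero = 0, add = (+)\<rparr>"

text \<open>
  The ideal class group in terms of integral ideals: every class of fractional ideals modulo
  principal ones contains a nonzero ideal of the ring of integers, and two such ideals are in
  the same class iff they become equal after scaling by nonzero integers of the field.
\<close>

definition nonzero_ideals :: "complex set \<Rightarrow> complex set set" where
  "nonzero_ideals K = {I. ideal I (ring_of_integers K) \<and> I \<noteq> {0}}"

definition ideal_class_rel :: "complex set \<Rightarrow> (complex set \<times> complex set) set" where
  "ideal_class_rel K = {(I, J). I \<in> nonzero_ideals K \<and> J \<in> nonzero_ideals K \<and>
     (\<exists>a \<in> carrier (ring_of_integers K) - {0}. \<exists>b \<in> carrier (ring_of_integers K) - {0}.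
        (\<lambda>x. a * x) ` I = (\<lambda>x. b * x) ` J)}"

definition class_number :: "complex set \<Rightarrow> nat" where
  "class_number K = card (nonzero_ideals K // ideal_class_rel K)"


section \<open>Cyclotomic classes and Gauss sums over finite fields\<close>

definition primitive_element :: "'a::{field,finite} \<Rightarrow> bool" where
  "primitive_element g \<longleftrightarrow> range (\<lambda>k::nat. g ^ k) = UNIV - {0}"

text \<open>
  As the multiplicative group is finite, the powers with natural exponents of an element
  already form the subgroup that it generates.
\<close>

definition cyclotomic_class :: "'a::{field,finite} \<Rightarrow> nat \<Rightarrow> nat \<Rightarrow> 'a set" where
  "cyclotomic_class g N i = (\<lambda>x. g ^ i * x) ` range (\<lambda>k::nat. (g ^ N) ^ k)"

definition primitive_root_of_unity :: "nat \<Rightarrow> complex \<Rightarrow> bool" where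
  "primitive_root_of_unity n z \<longleftrightarrow> n > 0 \<and> z ^ n = 1 \<and> (\<forall>k. 0 < k \<and> k < n \<longrightarrow> z ^ k \<noteq> 1)"

text \<open>
  Trace from the field with \<open>p ^ f\<close> elements to its prime field, as an element of the
  former: the sum of the conjugates under the Frobenius automorphism.
\<close>

definition field_trace :: "nat \<Rightarrow> nat \<Rightarrow> 'a::{field,finite} \<Rightarrow> 'a" where
  "field_trace p f x = (\<Sum>i<f. x ^ (p ^ i))"

text \<open>
  The exponent is the least natural number representing the trace modulo \<open>p\<close>; any other
  representative gives the same value when \<open>\<xi>\<close> is a \<open>p\<close>-th root of unity.
\<close>

definition additive_character :: "complex \<Rightarrow> nat \<Rightarrow> nat \<Rightarrow> 'a::{field,finite} \<Rightarrow> complex" where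
  "additive_character \<xi> p f x = \<xi> ^ (LEAST k::nat. of_nat k = field_trace p f x)"

text \<open>A multiplicative character is extended to the whole field by the value 0 at 0.\<close>

definition multiplicative_character :: "('a::{field,finite} \<Rightarrow> complex) \<Rightarrow> bool" where
  "multiplicative_character chi \<longleftrightarrow> chi 0 = 0 \<and> (\<forall>x. x \<noteq> 0 \<longrightarrow> chi x \<noteq> 0) \<and>
     (\<forall>x y. chi (x * y) = chi x * chi y)"

definition gauss_sum ::
    "complex \<Rightarrow> nat \<Rightarrow> nat \<Rightarrow> ('a::{field,finite} \<Rightarrow> complex) \<Rightarrow> complex" where
  "gauss_sum \<xi> p f chi = (\<Sum>a \<in> UNIV - {0}. chi a * additive_character \<xi> p f a)"


section \<open>Cayley graphs and strongly regular graphs\<close>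

text \<open>
  A simple undirected graph is represented by a loop-free digraph in which each edge occurs
  as a pair of opposite arcs; finite ones are the instances of the locale \<open>pair_graph\<close>.
\<close>

definition cayley_graph :: "'a::ab_group_add set \<Rightarrow> 'a pair_pre_digraph" where
  "cayley_graph D = \<lparr>pverts = UNIV, parcs = {(x, y). x - y \<in> D}\<rparr>"

definition common_neighbours :: "'a pair_pre_digraph \<Rightarrow> 'a \<Rightarrow> 'a \<Rightarrow> 'a set" where
  "common_neighbours G x y = {z \<in> pverts G. (x, z) \<in> parcs G \<and> (y, z) \<in> parcs G}"

definition strongly_regular_with ::
    "'a pair_pre_digraph \<Rightarrow> nat \<Rightarrow> nat \<Rightarrow> nat \<Rightarrow> nat \<Rightarrow> bool" where
  "strongly_regular_with G v k l \<mu> \<longleftrightarrow>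
     pair_graph G \<and> card (pverts G) = v \<and>
     (\<exists>x \<in> pverts G. \<exists>y \<in> pverts G. x \<noteq> y \<and> (x, y) \<notin> parcs G) \<and>
     parcs G \<noteq> {} \<and>
     (\<forall>x \<in> pverts G. card {y \<in> pverts G. (x, y) \<in> parcs G} = k) \<and>
     (\<forall>x \<in> pverts G. \<forall>y \<in> pverts G. (x, y) \<in> parcs G \<longrightarrow>
        card (common_neighbours G x y) = l) \<and>
     (\<forall>x \<in> pverts G. \<forall>y \<in> pverts G. x \<noteq> y \<and> (x, y) \<notin> parcs G \<longrightarrow>
        card (common_neighbours G x y) = \<mu>)"

definition strongly_regular :: "'a pair_pre_digraph \<Rightarrow> bool" where
  "strongly_regular G \<longleftrightarrow> (\<exists>v k l \<mu>. strongly_regular_with G v k l \<mu>)"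

end

theory Submission
  imports Defs
begin

text \<open>
  A Cayley graph on \<open>F\<^sub>q\<close> is strongly regular iff the sums \<open>\<psi>(aD)\<close>, \<open>a \<noteq> 0\<close>, take at
  most two values. Expand \<open>\<psi>(aD)\<close> in Gauss sums of powers of \<open>\<chi>\<close>. Since the indices \<open>i\<close>
  run through an interval of length \<open>p\<^sub>1 ^ (m - 1)\<close>, the nontrivial characters of order less
  than \<open>N\<close> cancel. For \<open>j\<close> prime to \<open>p\<^sub>1\<close>, invariance under Frobenius and complex
  conjugation make the Gauss sum of \<open>\<chi> ^ j\<close> depend only on the Legendre symbol of \<open>j\<close>,
  because \<open>\<langle>p\<rangle>\<close> is the group of squares modulo \<open>N\<close>. So \<open>\<psi>(aD)\<close> is a sum over residues
  modulo \<open>p\<^sub>1\<close> that the quadratic Gauss sum evaluates. Up to an additive constant, its values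
  are \<open>b p ^ h\<^sub>0 / 2\<close> and \<open>\<plusminus> c p ^ h\<^sub>0 / 2\<close>. As \<open>c \<noteq> 0\<close>, two of them coincide iff
  \<open>b = \<plusminus> c\<close>, and then \<open>b\<^sup>2 (1 + p\<^sub>1) = 4 p ^ h\<close> with \<open>p\<close> not dividing \<open>b\<close> gives \<open>b = \<plusminus> 1\<close>.
\<close>

section \<open>The additive character\<close>

text \<open>Multiplication by a nonzero \<open>x\<close> permutes the nonzero elements; comparing
  the products over them gives \<open>x ^ (CARD('a) - 1) = 1\<close>.\<close>

lemma finite_field_power_card:
  fixes x :: "'a::{field,finite}"
  shows "x ^ CARD('a) = x"
proof (cases "x = 0")
  case False
  have "(\<Prod>y\<in>UNIV - {0}. x * y) = \<Prod>(UNIV - {0})"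
    by (rule prod.reindex_bij_witness[of _ "\<lambda>y. y / x" "(*) x"]) (use False in auto)
  then have "x ^ (CARD('a) - 1) * \<Prod>(UNIV - {0}) = 1 * \<Prod>(UNIV - {0})"
    by (simp add: prod.distrib)
  then have "x ^ (CARD('a) - 1) = 1"
    by (subst (asm) mult_cancel_right) auto
  then show ?thesis
    using power_minus_mult[of "CARD('a)" x] by (simp add: finite_UNIV_card_ge_0)
qed (simp add: finite_UNIV_card_ge_0 power_0_left)

lemma CHAR_eq_if_CARD_eq_prime_power:
  assumes "prime p" and "CARD('a::{field,finite}) = p ^ f"
  shows "CHAR('a) = p"
proof -
  have "prime CHAR('a)"
    using prime_CHAR_semidom[where ?'a = 'a] finite_imp_CHAR_pos[where ?'a = 'a] by simp
  moreover have "CHAR('a) dvd p ^ f"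
    using CHAR_dvd_CARD[where ?'a = 'a] assms(2) by simp
  ultimately show ?thesis
    using assms(1) prime_dvd_power primes_dvd_imp_eq by blast
qed

section \<open>The trace to the prime field and the additive character it induces\<close>

context
  fixes p f :: nat and \<xi> :: complex
  assumes prime_p: "prime p" and card_field: "CARD('a::{field,finite}) = p ^ f"
    and root: "primitive_root_of_unity p \<xi>"
begin

private lemma char: "CHAR('a) = p"
  using CHAR_eq_if_CARD_eq_prime_power prime_p card_field by blast

lemma field_trace_add:
  "field_trace p f (x + y) = field_trace p f x + field_trace p f (y :: 'a)"
proof -
  have "(x + y) ^ (p ^ i) = x ^ (p ^ i) + y ^ (p ^ i)" for i
    by (rule freshmans_dream') (use char prime_p in auto)
  then show ?thesis
    by (simp add: field_trace_def sum.distrib)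
qed

text \<open>Frobenius shifts the conjugates cyclically, and the one that leaves the range,
  \<open>x ^ (p ^ f)\<close>, is \<open>x\<close> again.\<close>

lemma field_trace_frobenius: "field_trace p f (x ^ p) = field_trace p f (x :: 'a)"
proof -
  have "field_trace p f (x ^ p) = (\<Sum>i<f. x ^ (p ^ Suc i))"
    by (simp add: field_trace_def power_mult)
  also have "\<dots> + x ^ (p ^ 0) = (\<Sum>i<Suc f. x ^ (p ^ i))"
    by (subst sum.lessThan_Suc_shift) simp
  also have "\<dots> = field_trace p f x + x"
    using finite_field_power_card[of x] by (simp add: field_trace_def card_field)
  finally show ?thesis by simp
qed

lemma field_trace_power_prime: "field_trace p f x ^ p = field_trace p f (x :: 'a)"
proof -
  have "field_trace p f x ^ p = field_trace p f (x ^ p)"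
    unfolding field_trace_def
    by (subst freshmans_dream_sum)
       (use char prime_p in \<open>auto simp flip: power_mult simp: mult.commute\<close>)
  then show ?thesis
    by (simp add: field_trace_frobenius)
qed

private lemma of_nat_eq_iff: "(of_nat k :: 'a) = of_nat l \<longleftrightarrow> [k = l] (mod p)"
  using of_nat_eq_iff_cong_CHAR[where ?'a = 'a] char by simp

text \<open>The \<open>p\<close> residues are distinct roots of \<open>X ^ p - X\<close>, whose
  degree leaves no room for others. With \<open>field_trace_power_prime\<close> this puts every
  trace into the prime field, so the exponent in \<open>additive_character\<close> exists.\<close>

lemma fixed_by_frobenius_imp_of_nat:
  fixes y :: 'a
  assumes "y ^ p = y"
  shows "\<exists>k. of_nat k = y"
proof -
  define P :: "'a poly" where "P = Polynomial.monom 1 p - Polynomial.monom 1 1"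
  have p1: "p > 1"
    using prime_p by (rule prime_gt_1_nat)
  have "poly.coeff P p = 1"
    using p1 by (simp add: P_def)
  then have "P \<noteq> 0" by auto
  have deg: "degree P \<le> p"
    unfolding P_def using p1 by (intro degree_diff_le) (auto intro: degree_monom_le order.trans)
  have pow: "(of_nat k :: 'a) ^ p = of_nat k" for k
    by (induction k) (use p1 in \<open>auto simp: char prime_p freshmans_dream\<close>)
  have roots: "{z. poly P z = 0} = {z. z ^ p = z}"
    by (simp add: P_def poly_monom)
  have sub: "of_nat ` {..<p} \<subseteq> {z :: 'a. z ^ p = z}"
    using pow by auto
  have "card (of_nat ` {..<p} :: 'a set) = p"
    by (subst card_image) (auto simp: inj_on_def of_nat_eq_iff cong_def)
  moreover have "card {z :: 'a. z ^ p = z} \<le> p"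
    using card_poly_roots_bound[OF \<open>P \<noteq> 0\<close>] roots deg by simp
  ultimately have "of_nat ` {..<p} = {z :: 'a. z ^ p = z}"
    using sub card_seteq[OF finite sub] by simp
  then have "y \<in> of_nat ` {..<p}"
    using assms by simp
  then show ?thesis by blast
qed

lemma field_degree_pos: "f > 0"
proof (rule ccontr)
  assume "\<not> f > 0"
  then have "card (UNIV :: 'a set) \<le> 1"
    using card_field by simp
  then show False
    using card_le_Suc0_iff_eq[of "UNIV :: 'a set"] zero_neq_one[where ?'a = 'a]
    by (simp del: zero_neq_one)
qed

text \<open>As \<open>y ^ (p ^ f) = y\<close>, a \<open>p\<close>-th root of \<open>y\<close> is
  \<open>y ^ (p ^ (f - 1))\<close>; a surjection of a finite set to itself is injective.\<close>

lemma bij_frobenius: "bij (\<lambda>x :: 'a. x ^ p)"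
proof -
  have "\<exists>x. y = x ^ p" for y :: 'a
  proof
    have "y = y ^ (p ^ Suc (f - 1))"
      using finite_field_power_card[of y] card_field field_degree_pos by simp
    then show "y = (y ^ p ^ (f - 1)) ^ p"
      by (simp add: mult.commute flip: power_mult)
  qed
  then have "surj (\<lambda>x :: 'a. x ^ p)"
    by (simp add: surj_def)
  then show ?thesis
    using finite_UNIV_surj_inj[of "\<lambda>x :: 'a. x ^ p"] by (simp add: bij_def)
qed

text \<open>The trace is given by a polynomial of degree at most \<open>p ^ (f - 1)\<close>, too
  small to vanish at all \<open>p ^ f\<close> elements.\<close>

lemma field_trace_nonzero: "\<exists>x :: 'a. field_trace p f x \<noteq> 0"
proof (rule ccontr)
  assume "\<not> ?thesis"
  then have zero: "field_trace p f x = 0" for x :: 'a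
    by simp
  have p1: "p > 1"
    using prime_p by (rule prime_gt_1_nat)
  define P :: "'a poly" where "P = (\<Sum>i<f. Polynomial.monom 1 (p ^ i))"
  \<comment> \<open>Only \<open>i = 0\<close> contributes to the linear coefficient, which shows
    that \<open>P\<close> is not the zero polynomial.\<close>
  have "poly.coeff P 1 = (\<Sum>i<f. if i = 0 then 1 else 0)"
    unfolding P_def coeff_sum
    by (rule sum.cong) (use p1 in auto)
  then have "P \<noteq> 0"
    using field_degree_pos by auto
  moreover have "{z. poly P z = 0} = UNIV"
    using zero by (auto simp: P_def poly_sum poly_monom field_trace_def)
  ultimately have "p ^ f \<le> degree P"
    using card_poly_roots_bound[of P] card_field by simp
  also have "degree P \<le> p ^ (f - 1)"
    unfolding P_def
  proof (rule degree_sum_le)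
    fix i assume "i \<in> {..<f}"
    then have "p ^ i \<le> p ^ (f - 1)"
      using p1 by (intro power_increasing) auto
    then show "degree (Polynomial.monom (1 :: 'a) (p ^ i)) \<le> p ^ (f - 1)"
      using degree_monom_le order.trans by blast
  qed simp
  also have "\<dots> < p ^ f"
    using p1 field_degree_pos by (intro power_strict_increasing) auto
  finally show False by simp
qed

lemma additive_character_eq:
  assumes "of_nat k = field_trace p f (x :: 'a)"
  shows "additive_character \<xi> p f x = \<xi> ^ k"
proof -
  define l where "l = (LEAST k. of_nat k = field_trace p f x)"
  have "of_nat l = field_trace p f x"
    unfolding l_def by (rule LeastI) (rule assms)
  then have "[l = k] (mod p)"
    using assms of_nat_eq_iff by metis
  have "\<xi> ^ p = 1"
    using root by (simp add: primitive_root_of_unity_def)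
  then have red: "\<xi> ^ n = \<xi> ^ (n mod p)" for n
    by (metis mult_div_mod_eq mult_1 power_add power_mult power_one)
  have "\<xi> ^ l = \<xi> ^ k"
    using \<open>[l = k] (mod p)\<close> red unfolding cong_def by metis
  then show ?thesis
    by (simp add: additive_character_def l_def)
qed

lemma field_trace_in_prime_field: "\<exists>k. of_nat k = field_trace p f (x :: 'a)"
  by (rule fixed_by_frobenius_imp_of_nat) (rule field_trace_power_prime)

lemma additive_character_add:
  "additive_character \<xi> p f (x + y :: 'a) =
     additive_character \<xi> p f x * additive_character \<xi> p f y"
proof -
  obtain k l where kl: "of_nat k = field_trace p f x" "of_nat l = field_trace p f y"
    using field_trace_in_prime_field by metis
  then have "of_nat (k + l) = field_trace p f (x + y)"
    by (simp add: field_trace_add)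
  then show ?thesis
    using kl additive_character_eq by (metis power_add)
qed

lemma additive_character_frobenius:
  "additive_character \<xi> p f (x ^ p :: 'a) = additive_character \<xi> p f x"
  by (simp add: additive_character_def field_trace_frobenius)

lemma norm_additive_character: "norm (additive_character \<xi> p f (x :: 'a)) = 1"
proof -
  have "\<xi> ^ p = 1" "p > 0"
    using root by (auto simp: primitive_root_of_unity_def)
  then have "norm \<xi> = 1"
    using power_eq_1_iff by blast
  then show ?thesis
    by (simp add: additive_character_def norm_power)
qed

text \<open>A nonzero trace is represented by some \<open>k\<close> with \<open>0 < k < p\<close>,
  where primitivity of \<xi> excludes \<open>\<xi> ^ k = 1\<close>.\<close>

lemma additive_character_nontrivial: "\<exists>x :: 'a. additive_character \<xi> p f x \<noteq> 1"
proof -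
  obtain x :: 'a where x: "field_trace p f x \<noteq> 0"
    using field_trace_nonzero by blast
  obtain k where k: "of_nat k = field_trace p f x"
    using field_trace_in_prime_field by metis
  then have "of_nat (k mod p) = field_trace p f x"
    using of_nat_eq_iff[of "k mod p" k] by (simp add: cong_def)
  moreover from this have "k mod p > 0"
    using x by (metis neq0_conv of_nat_0)
  moreover have "k mod p < p"
    using prime_p prime_gt_0_nat by simp
  ultimately show ?thesis
    using root additive_character_eq unfolding primitive_root_of_unity_def by metis
qed

end

section \<open>Strongly regular Cayley graphs\<close>

context
  fixes \<psi> :: "'a::{field,finite} \<Rightarrow> complex"
  assumes add: "\<And>x y. \<psi> (x + y) = \<psi> x * \<psi> y"
    and norm: "\<And>x. norm (\<psi> x) = 1"
    and nontrivial: "\<exists>x. \<psi> x \<noteq> 1"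
begin

private lemma zero: "\<psi> 0 = 1"
  using add[of 0 0] norm[of 0] by (metis add.right_neutral mult_cancel_left2 norm_zero zero_neq_one)

private lemma inverse: "\<psi> x * \<psi> (- x) = 1"
  using add[of x "- x"] zero by simp

lemma cnj_character: "cnj (\<psi> x) = \<psi> (- x)"
proof -
  have "\<psi> x * cnj (\<psi> x) = \<psi> x * \<psi> (- x)"
    using norm[of x] inverse[of x] complex_norm_square[of "\<psi> x"] by simp
  then show ?thesis
    using norm[of x] by (metis mult_cancel_left norm_zero zero_neq_one)
qed

text \<open>Translation by some \<open>y\<close> with \<open>\<psi> y \<noteq> 1\<close> permutes
  the terms and yet multiplies the sum by \<open>\<psi> y\<close>.\<close>

lemma sum_character: "(\<Sum>x\<in>UNIV. \<psi> x) = 0"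
proof -
  obtain y where y: "\<psi> y \<noteq> 1"
    using nontrivial by blast
  have "(\<Sum>x\<in>UNIV. \<psi> x) = (\<Sum>x\<in>UNIV. \<psi> (y + x))"
    by (rule sum.reindex_bij_witness[of _ "\<lambda>x. y + x" "\<lambda>x. x - y"]) auto
  also have "\<dots> = \<psi> y * (\<Sum>x\<in>UNIV. \<psi> x)"
    by (simp add: add sum_distrib_left)
  finally show ?thesis
    using y by (metis mult_cancel_right2)
qed

lemma character_orthogonality:
  "(\<Sum>a\<in>UNIV. \<psi> (a * x)) = (if x = 0 then of_nat CARD('a) else 0)"
proof (cases "x = 0")
  case False
  have "(\<Sum>a\<in>UNIV. \<psi> (a * x)) = (\<Sum>a\<in>UNIV. \<psi> a)"
    by (rule sum.reindex_bij_witness[of _ "\<lambda>a. a / x" "\<lambda>a. a * x"]) (use False in auto)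
  then show ?thesis
    using False sum_character by simp
qed (simp add: zero)

text \<open>After exchanging the sums, orthogonality leaves only the term
  \<open>x = y\<close>.\<close>

lemma fourier_inversion:
  fixes u :: "'a \<Rightarrow> complex"
  shows "(\<Sum>a\<in>UNIV. (\<Sum>x\<in>UNIV. u x * \<psi> (a * x)) * \<psi> (- (a * y))) = of_nat CARD('a) * u y"
proof -
  have "(\<Sum>a\<in>UNIV. (\<Sum>x\<in>UNIV. u x * \<psi> (a * x)) * \<psi> (- (a * y))) =
        (\<Sum>a\<in>UNIV. \<Sum>x\<in>UNIV. u x * \<psi> (a * (x - y)))"
    by (simp add: sum_distrib_right mult.assoc right_diff_distrib flip: add)
  also have "\<dots> = (\<Sum>x\<in>UNIV. u x * (\<Sum>a\<in>UNIV. \<psi> (a * (x - y))))"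
    by (subst sum.swap) (simp add: sum_distrib_left)
  also have "\<dots> = (\<Sum>x\<in>UNIV. if x = y then u x * of_nat CARD('a) else 0)"
    by (rule sum.cong) (auto simp: character_orthogonality)
  finally show ?thesis
    by (simp add: mult.commute)
qed

text \<open>In the inversion formula only the frequency \<open>a = 0\<close> survives, and it
  contributes the same at every point.\<close>

lemma fourier_transform_zero_imp_constant:
  fixes u :: "'a \<Rightarrow> complex"
  assumes "\<And>a. a \<noteq> 0 \<Longrightarrow> (\<Sum>x\<in>UNIV. u x * \<psi> (a * x)) = 0"
  shows "u y = u z"
proof -
  have "of_nat CARD('a) * u w = (\<Sum>x\<in>UNIV. u x)" for w
  proof -
    have "of_nat CARD('a) * u w =
            (\<Sum>a\<in>(UNIV :: 'a set). if a = 0 then (\<Sum>x\<in>UNIV. u x) else 0)"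
      unfolding fourier_inversion[symmetric]
      by (rule sum.cong) (auto simp: assms zero)
    then show ?thesis by simp
  qed
  then have "of_nat CARD('a) * u y = of_nat CARD('a) * u z"
    by metis
  then show ?thesis
    by (simp add: finite_UNIV_card_ge_0)
qed

section \<open>Difference counts in a symmetric set and strong regularity\<close>

context
  fixes D :: "'a set"
  assumes D_uminus: "\<And>x. x \<in> D \<Longrightarrow> - x \<in> D" and D_zero: "0 \<notin> D"
begin

text \<open>Counts the ways to write \<open>t\<close> as a difference of two elements of
  \<open>D\<close>, namely \<open>t = (t + e) - e\<close>.\<close>

private definition diffs :: "'a \<Rightarrow> nat" where
  "diffs t = card {e \<in> D. t + e \<in> D}"

text \<open>For a common neighbour \<open>z\<close> put \<open>e = y - z\<close>; then
  \<open>x - z = (x - y) + e\<close>.\<close>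

private lemma card_common_neighbours:
  "card (common_neighbours (cayley_graph D) x y) = diffs (x - y)"
proof -
  have "bij_betw (\<lambda>z. y - z) (common_neighbours (cayley_graph D) x y)
          {e \<in> D. x - y + e \<in> D}"
    by (rule bij_betw_byWitness[of _ "\<lambda>e. y - e"])
       (auto simp: common_neighbours_def cayley_graph_def algebra_simps)
  then show ?thesis
    unfolding diffs_def by (rule bij_betw_same_card)
qed

private lemma diffs_zero: "diffs 0 = card D"
  by (simp add: diffs_def)

private lemma card_neighbours: "card {y. x - y \<in> D} = card D"
proof -
  have "bij_betw (\<lambda>y. x - y) {y. x - y \<in> D} D"
    by (rule bij_betw_byWitness[of _ "\<lambda>e. x - e"]) auto
  then show ?thesis by (rule bij_betw_same_card)
qed

private lemma pair_graph_cayley: "pair_graph (cayley_graph D)"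
proof
  show "Digraph.symmetric (with_proj (cayley_graph D))"
    using D_uminus by (force simp: Digraph.symmetric_def sym_def cayley_graph_def)
qed (use D_zero in \<open>auto simp: cayley_graph_def\<close>)

text \<open>The count is the convolution of the indicators of \<open>D\<close> and
  \<open>- D\<close>, so its transform is the product of theirs; the symmetry of \<open>D\<close>
  makes this a square.\<close>

private lemma diffs_transform:
  "(\<Sum>t\<in>UNIV. of_nat (diffs t) * \<psi> (a * t)) = (\<Sum>d\<in>D. \<psi> (a * d))\<^sup>2"
proof -
  have "(\<Sum>t\<in>UNIV. of_nat (diffs t) * \<psi> (a * t)) =
        (\<Sum>t\<in>UNIV. \<Sum>e\<in>D. if t + e \<in> D then \<psi> (a * t) else 0)"
    by (simp add: diffs_def flip: sum.inter_filter)
  also have "\<dots> = (\<Sum>e\<in>D. \<Sum>t\<in>UNIV. if t + e \<in> D then \<psi> (a * t) else 0)"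
    by (rule sum.swap)
  also have "\<dots> = (\<Sum>e\<in>D. \<Sum>d\<in>D. \<psi> (a * (d - e)))"
  proof (rule sum.cong)
    fix e assume "e \<in> D"
    have "(\<Sum>t\<in>UNIV. if t + e \<in> D then \<psi> (a * t) else 0) =
          (\<Sum>t\<in>{t. t + e \<in> D}. \<psi> (a * t))"
      by (simp add: sum.If_cases)
    also have "\<dots> = (\<Sum>d\<in>D. \<psi> (a * (d - e)))"
      by (rule sum.reindex_bij_witness[of _ "\<lambda>d. d - e" "\<lambda>t. t + e"]) auto
    finally show "(\<Sum>t\<in>UNIV. if t + e \<in> D then \<psi> (a * t) else 0) =
                  (\<Sum>d\<in>D. \<psi> (a * (d - e)))" .
  qed simp
  also have "\<dots> = (\<Sum>e\<in>D. \<psi> (a * (- e))) * (\<Sum>d\<in>D. \<psi> (a * d))"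
    by (subst sum_product) (simp add: right_diff_distrib add.commute flip: add)
  also have "(\<Sum>e\<in>D. \<psi> (a * (- e))) = (\<Sum>d\<in>D. \<psi> (a * d))"
    by (rule sum.reindex_bij_witness[of _ uminus uminus]) (use D_uminus in auto)
  finally show ?thesis
    by (simp add: power2_eq_square)
qed

private lemma delta_transform:
  "(\<Sum>t\<in>UNIV. (if t = 0 then w else 0) * \<psi> (a * t)) = w"
proof -
  have "(\<Sum>t\<in>UNIV. (if t = 0 then w else 0) * \<psi> (a * t)) =
        (\<Sum>t\<in>(UNIV :: 'a set). if t = 0 then w else 0)"
    by (rule sum.cong) (auto simp: zero)
  then show ?thesis by simp
qed

private lemma indicator_transform:
  "(\<Sum>t\<in>UNIV. (if t \<in> D then w else 0) * \<psi> (a * t)) = w * (\<Sum>d\<in>D. \<psi> (a * d))"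
proof -
  have "(\<Sum>t\<in>UNIV. (if t \<in> D then w else 0) * \<psi> (a * t)) =
        (\<Sum>t\<in>UNIV. if t \<in> D then w * \<psi> (a * t) else 0)"
    by (rule sum.cong) auto
  then show ?thesis
    by (simp add: sum.If_cases sum_distrib_left)
qed

private lemma constant_transform:
  assumes "a \<noteq> 0"
  shows "(\<Sum>t\<in>UNIV. w * \<psi> (a * t)) = 0"
proof -
  have "(\<Sum>t\<in>UNIV. w * \<psi> (a * t)) = w * (\<Sum>t\<in>UNIV. \<psi> (t * a))"
    by (simp add: sum_distrib_left mult.commute)
  then show ?thesis
    using character_orthogonality[of a] assms by simp
qed

text \<open>
  The function counting the representations as a difference of two elements of \<open>D\<close> has as
  its Fourier transform the square of that of \<open>D\<close>. Hence it is a combination of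
  the indicator functions of \<open>{0}\<close>, \<open>D\<close> and the whole field iff the
  transform of \<open>D\<close> satisfies a quadratic equation away from 0.
\<close>
lemma strongly_regular_cayley_graph_iff:
  assumes "D \<noteq> {}" and "\<exists>x. x \<noteq> 0 \<and> x \<notin> D"
  shows "strongly_regular (cayley_graph D) \<longleftrightarrow>
    (\<exists>r s. \<forall>a. a \<noteq> 0 \<longrightarrow> (\<Sum>d\<in>D. \<psi> (a * d)) \<in> {r, s})"
proof
  assume "strongly_regular (cayley_graph D)"
  then obtain v k l \<mu> where "strongly_regular_with (cayley_graph D) v k l \<mu>"
    by (auto simp: strongly_regular_def)
  then have 1: "x - y \<in> D \<Longrightarrow> diffs (x - y) = l"
    and 2: "x \<noteq> y \<Longrightarrow> x - y \<notin> D \<Longrightarrow> diffs (x - y) = \<mu>" for x y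
    using card_common_neighbours
    by (simp_all add: strongly_regular_with_def cayley_graph_def)
  \<comment> \<open>The count is \<open>card D\<close> at 0, \<open>l\<close> on \<open>D\<close>
    and \<open>\<mu>\<close> elsewhere. Relative to the constant \<open>\<mu>\<close>, the excess is
    \<open>w\<close> on \<open>D\<close> and \<open>w'\<close> at 0.\<close>
  define w :: complex where "w = of_nat l - of_nat \<mu>"
  define w' :: complex where "w' = of_nat (card D) - of_nat \<mu>"
  have "of_nat (diffs t) = (if t = 0 then w' else 0) + (if t \<in> D then w else 0) + of_nat \<mu>" for t
    using 1[of t 0] 2[of t 0] diffs_zero D_zero by (auto simp: w_def w'_def)
  then have quad: "(\<Sum>d\<in>D. \<psi> (a * d))\<^sup>2 = w' + w * (\<Sum>d\<in>D. \<psi> (a * d))" if "a \<noteq> 0" for a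
    using diffs_transform[of a, symmetric] constant_transform[OF that]
    by (simp only: distrib_right sum.distrib delta_transform indicator_transform) simp
  \<comment> \<open>A square root of the discriminant of \<open>z\<^sup>2 - w * z - w'\<close>, of
    which every transform value is a root.\<close>
  define \<delta> where "\<delta> = csqrt (w\<^sup>2 + 4 * w')"
  have \<delta>: "\<delta>\<^sup>2 = w\<^sup>2 + 4 * w'"
    by (simp add: \<delta>_def)
  have "z \<in> {(w + \<delta>) / 2, (w - \<delta>) / 2}" if "z\<^sup>2 = w' + w * z" for z
  proof -
    have "(2 * z - w - \<delta>) * (2 * z - w + \<delta>) = (2 * z - w)\<^sup>2 - \<delta>\<^sup>2"
      by (simp add: power2_eq_square algebra_simps)
    also have "\<dots> = 4 * z\<^sup>2 - 4 * (w' + w * z)"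
      unfolding \<delta> by (simp add: power2_eq_square algebra_simps)
    finally have "2 * z - w - \<delta> = 0 \<or> 2 * z - w + \<delta> = 0"
      using that by simp
    then show ?thesis
      by (auto simp: field_simps)
  qed
  then show "\<exists>r s. \<forall>a. a \<noteq> 0 \<longrightarrow> (\<Sum>d\<in>D. \<psi> (a * d)) \<in> {r, s}"
    using quad by blast
next
  assume "\<exists>r s. \<forall>a. a \<noteq> 0 \<longrightarrow> (\<Sum>d\<in>D. \<psi> (a * d)) \<in> {r, s}"
  then obtain r s where rs: "\<And>a. a \<noteq> 0 \<Longrightarrow> (\<Sum>d\<in>D. \<psi> (a * d)) \<in> {r, s}"
    by blast
  \<comment> \<open>The coefficients are those of \<open>(z - r) * (z - s)\<close>, so that the
    transform of \<open>u\<close> away from 0 is this polynomial evaluated at the transform of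
    \<open>D\<close>. Constancy of \<open>u\<close> then gives constancy of \<open>diffs\<close> on
    \<open>D\<close> and on the remaining nonzero elements.\<close>
  define u where
    "u t = of_nat (diffs t) + (if t = 0 then r * s else 0) + (if t \<in> D then - (r + s) else 0)" for t
  have "(\<Sum>t\<in>UNIV. u t * \<psi> (a * t)) = 0" if "a \<noteq> 0" for a
  proof -
    define S where "S = (\<Sum>d\<in>D. \<psi> (a * d))"
    have "(\<Sum>t\<in>UNIV. u t * \<psi> (a * t)) = S\<^sup>2 + r * s + - (r + s) * S"
      by (simp only: u_def distrib_right sum.distrib delta_transform indicator_transform
          diffs_transform S_def)
    also have "\<dots> = (S - r) * (S - s)"
      by (simp add: power2_eq_square algebra_simps)
    finally show ?thesis
      using rs[OF that] by (auto simp: S_def)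
  qed
  then have const: "u t = u t'" for t t'
    by (rule fourier_transform_zero_imp_constant)
  have diffs_D: "diffs t = diffs t'" if "t \<in> D" "t' \<in> D" for t t'
    proof -
    have "t \<noteq> 0" "t' \<noteq> 0"
      using that D_zero by auto
    then show ?thesis
      using const[of t t'] that by (simp add: u_def)
  qed
  have diffs_not_D: "diffs t = diffs t'" if "t \<notin> D" "t' \<notin> D" "t \<noteq> 0" "t' \<noteq> 0" for t t'
    using const[of t t'] that by (simp add: u_def)
  obtain x y where x: "x \<in> D" and y: "y \<noteq> 0" "y \<notin> D"
    using assms by blast
  have "strongly_regular_with (cayley_graph D) CARD('a) (card D) (diffs x) (diffs y)"
    unfolding strongly_regular_with_def card_common_neighbours
  proof (intro conjI ballI impI)
    show "pair_graph (cayley_graph D)"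
      by (rule pair_graph_cayley)
    show "\<exists>x\<in>pverts (cayley_graph D). \<exists>y\<in>pverts (cayley_graph D).
            x \<noteq> y \<and> (x, y) \<notin> parcs (cayley_graph D)"
      using y by (intro bexI[of _ y] bexI[of _ 0]) (auto simp: cayley_graph_def)
    have "(x, 0) \<in> parcs (cayley_graph D)"
      using x by (simp add: cayley_graph_def)
    then show "parcs (cayley_graph D) \<noteq> {}" by blast
  qed (use x y in \<open>auto simp: cayley_graph_def card_neighbours intro: diffs_D diffs_not_D\<close>)
  then show "strongly_regular (cayley_graph D)"
    by (auto simp: strongly_regular_def)
qed

end

end

section \<open>Legendre symbols and quadratic Gauss sums\<close>

lemma Legendre_range: "Legendre a p \<in> {- 1, 0, 1}"
  by (simp add: Legendre_def)

lemma Legendre_cong: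
  assumes "[a = b] (mod p)"
  shows "Legendre a p = Legendre b p"
proof -
  have "[a = 0] (mod p) \<longleftrightarrow> [b = 0] (mod p)" "QuadRes p a \<longleftrightarrow> QuadRes p b"
    using assms unfolding QuadRes_def by (meson cong_sym cong_trans)+
  then show ?thesis
    by (simp add: Legendre_def)
qed

lemma Legendre_eq_0_iff: "Legendre a p = 0 \<longleftrightarrow> p dvd a"
  by (simp add: Legendre_def cong_0_iff)

text \<open>Two values in \<open>{- 1, 0, 1}\<close> differ by at most 2, which is less than
  \<open>p\<close>. This turns the congruences from Euler's criterion into equations.\<close>

lemma Legendre_eqI:
  assumes "p > 2" and "[Legendre a (int p) = x] (mod int p)" and "x \<in> {- 1, 0, 1}"
  shows "Legendre a (int p) = x"
proof (rule ccontr)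
  assume "Legendre a (int p) \<noteq> x"
  moreover have "int p dvd Legendre a (int p) - x"
    using assms(2) by (simp add: cong_iff_dvd_diff)
  ultimately have "int p \<le> \<bar>Legendre a (int p) - x\<bar>"
    by (intro zdvd_imp_le) (auto simp: zero_less_abs_iff)
  then show False
    using Legendre_range[of a "int p"] assms(1,3) by auto
qed

lemma Legendre_mult:
  assumes "prime p" and "p > 2"
  shows "Legendre (a * b) (int p) = Legendre a (int p) * Legendre b (int p)"
proof (rule Legendre_eqI)
  have "[Legendre (a * b) (int p) = (a * b) ^ ((p - 1) div 2)] (mod int p)"
    using assms by (rule euler_criterion)
  moreover have "[Legendre a (int p) * Legendre b (int p) =
      a ^ ((p - 1) div 2) * b ^ ((p - 1) div 2)] (mod int p)"
    using assms by (intro cong_mult euler_criterion)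
  ultimately show "[Legendre (a * b) (int p) = Legendre a (int p) * Legendre b (int p)] (mod int p)"
    using cong_sym cong_trans unfolding power_mult_distrib by blast
  show "Legendre a (int p) * Legendre b (int p) \<in> {- 1, 0, 1}"
    using Legendre_range[of a "int p"] Legendre_range[of b "int p"] by auto
qed (rule assms(2))

lemma Legendre_1:
  assumes "p > 2"
  shows "Legendre 1 (int p) = 1"
proof -
  have "QuadRes (int p) 1"
    unfolding QuadRes_def by (rule exI[of _ 1]) simp
  then show ?thesis
    using assms by (auto simp: Legendre_def cong_0_iff)
qed

lemma Legendre_power:
  assumes "prime p" and "p > 2"
  shows "Legendre (a ^ n) (int p) = Legendre a (int p) ^ n"
  by (induction n) (use assms in \<open>auto simp: Legendre_1 Legendre_mult\<close>)

text \<open>In other words \<open>(p - 1) / 2\<close> is odd, which makes -1 a nonresidue and a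
  subgroup of index two in the units of odd order.\<close>

lemma half_pred_odd:
  fixes p :: nat
  assumes "[p = 3] (mod 4)"
  shows "\<exists>k. p - 1 = 2 * (2 * k + 1)"
proof -
  have "p mod 4 = 3"
    using assms by (simp add: cong_def)
  then have "p - 1 = 2 * (2 * (p div 4) + 1)"
    by presburger
  then show ?thesis by blast
qed

lemma Legendre_uminus:
  assumes "prime p" and "p > 2" and "[p = 3] (mod 4)"
  shows "Legendre (- a) (int p) = - Legendre a (int p)"
proof -
  obtain k where "p - 1 = 2 * (2 * k + 1)"
    using half_pred_odd assms(3) by blast
  then have "(- 1 :: int) ^ ((p - 1) div 2) = - 1"
    by simp
  then have "Legendre (- 1) (int p) = - 1"
    using euler_criterion[OF assms(1,2), of "- 1"] assms(2) by (intro Legendre_eqI) auto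
  then show ?thesis
    using Legendre_mult[OF assms(1,2), of "- 1" a] by simp
qed

lemma sum_powers_root_of_unity:
  fixes z :: complex
  assumes "z ^ n = 1"
  shows "(\<Sum>k<n. z ^ k) = (if z = 1 then of_nat n else 0)"
  using assms by (simp add: sum_gp_strict)

lemma primitive_root_power_mod:
  assumes "primitive_root_of_unity n z"
  shows "z ^ (k mod n) = z ^ k"
proof -
  have "z ^ n = 1"
    using assms by (simp add: primitive_root_of_unity_def)
  then show ?thesis
    by (metis mult_div_mod_eq mult_1 power_add power_mult power_one)
qed

lemma primitive_root_power_eq_1_iff:
  assumes "primitive_root_of_unity n z"
  shows "z ^ k = 1 \<longleftrightarrow> n dvd k"
proof -
  have "k mod n < n"
    using assms by (simp add: primitive_root_of_unity_def)
  then have "z ^ (k mod n) = 1 \<longleftrightarrow> k mod n = 0"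
    using assms unfolding primitive_root_of_unity_def by (metis neq0_conv power_0)
  then show ?thesis
    by (simp add: primitive_root_power_mod[OF assms] dvd_eq_mod_eq_0)
qed

text \<open>The outer \<open>mod n\<close> matters when \<open>n\<close> divides \<open>k\<close>:
  the complement is then 0 and not \<open>n\<close>.\<close>

lemma dvd_add_iff_eq_complement:
  fixes n k i :: nat
  assumes "i < n"
  shows "n dvd k + i \<longleftrightarrow> i = (n - k mod n) mod n"
proof -
  have "n dvd k + i \<longleftrightarrow> (k mod n + i) mod n = (k mod n + (n - k mod n)) mod n"
    using assms by (simp add: dvd_eq_mod_eq_0 mod_add_left_eq)
  also have "\<dots> \<longleftrightarrow> [i = n - k mod n] (mod n)"
    using cong_add_lcancel_nat[of "k mod n" i "n - k mod n" n] by (simp add: cong_def)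
  finally show ?thesis
    using assms by (simp add: cong_def)
qed

section \<open>Quadratic Gauss sums modulo a prime congruent to 3 modulo 4\<close>

context
  fixes p :: nat and \<zeta> :: complex
  assumes prime_p: "prime p" and p_gt_2: "p > 2" and p_mod_4: "[p = 3] (mod 4)"
    and root: "primitive_root_of_unity p \<zeta>"
begin

private abbreviation lg :: "nat \<Rightarrow> complex" where
  "lg v \<equiv> of_int (Legendre (int v) (int p))"

definition twisted_sum :: "nat \<Rightarrow> complex" where
  "twisted_sum t = (\<Sum>v<p. lg v * \<zeta> ^ (t * v))"

lemma sum_root_powers: "(\<Sum>v<p. \<zeta> ^ (t * v)) = (if p dvd t then of_nat p else 0)"
  using sum_powers_root_of_unity[of "\<zeta> ^ t" p]
  by (simp add: primitive_root_power_eq_1_iff[OF root] flip: power_mult)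

private lemma lg_mod: "lg (n mod p) = lg n"
  by (simp add: zmod_int Legendre_cong[of "int n mod int p" "int n"] cong_def)

private lemma lg_mult: "lg (m * n) = lg m * lg n"
  by (simp add: Legendre_mult[OF prime_p p_gt_2])

lemma bij_betw_mult_mod:
  assumes "\<not> p dvd t"
  shows "bij_betw (\<lambda>v. t * v mod p) {..<p} {..<p}"
proof -
  have "inj_on (\<lambda>v. t * v mod p) {..<p}"
  proof (rule inj_onI)
    fix v w assume vw: "v \<in> {..<p}" "w \<in> {..<p}" and "t * v mod p = t * w mod p"
    then have "[t * v = t * w] (mod p)"
      by (simp add: cong_def)
    moreover have "coprime t p"
      using assms prime_p by (metis coprime_commute prime_imp_coprime)
    ultimately have "[v = w] (mod p)"
      by (simp add: cong_mult_lcancel_nat)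
    then show "v = w"
      using vw by (simp add: cong_def)
  qed
  moreover have "(\<lambda>v. t * v mod p) ` {..<p} \<subseteq> {..<p}"
    using p_gt_2 by auto
  ultimately show ?thesis
    by (simp add: bij_betw_def endo_inj_surj)
qed

private lemma lg_square:
  assumes "\<not> p dvd t"
  shows "lg t * lg t = 1"
proof -
  have "Legendre (int t) (int p) \<noteq> 0"
    using assms by (simp add: Legendre_eq_0_iff)
  then have "Legendre (int t) (int p) * Legendre (int t) (int p) = 1"
    using Legendre_range[of "int t" "int p"] by auto
  then show ?thesis
    by (metis of_int_1 of_int_mult)
qed

text \<open>The substitution of \<open>- v\<close> for \<open>v\<close>, realised on natural numbers
  as multiplication by \<open>p - 1\<close>, changes the sign of every term.\<close>

lemma sum_Legendre: "(\<Sum>v<p. lg v) = 0"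
proof -
  have "\<not> p dvd (p - 1)"
    using p_gt_2 by (auto dest: dvd_imp_le)
  then have "(\<Sum>v<p. lg v) = (\<Sum>v<p. lg ((p - 1) * v mod p))"
    using sum.reindex_bij_betw[OF bij_betw_mult_mod, of "p - 1" lg] by simp
  also have "\<dots> = (\<Sum>v<p. - lg v)"
  proof (rule sum.cong)
    fix v assume "v \<in> {..<p}"
    have "[int ((p - 1) * v) = - int v] (mod int p)"
      using p_gt_2 by (simp add: of_nat_diff cong_iff_dvd_diff algebra_simps)
    then show "lg ((p - 1) * v mod p) = - lg v"
      unfolding lg_mod
      using Legendre_cong Legendre_uminus[OF prime_p p_gt_2 p_mod_4] by (metis of_int_minus)
  qed simp
  finally show ?thesis
    by (simp add: sum_negf)
qed

text \<open>For \<open>t\<close> prime to \<open>p\<close>, replace \<open>v\<close> by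
  \<open>t * v\<close> in \<open>twisted_sum 1\<close>. Otherwise both sides vanish, the left one by
  \<open>sum_Legendre\<close>.\<close>

lemma twisted_sum_eq: "twisted_sum t = lg t * twisted_sum 1"
proof (cases "p dvd t")
  case True
  then have "\<zeta> ^ (t * v) = 1" for v
    by (simp add: primitive_root_power_eq_1_iff[OF root])
  then show ?thesis
    using True sum_Legendre Legendre_eq_0_iff[of "int t" "int p"] by (simp add: twisted_sum_def)
next
  case False
  have "twisted_sum 1 = (\<Sum>v<p. lg (t * v mod p) * \<zeta> ^ (t * v mod p))"
    unfolding twisted_sum_def
    using sum.reindex_bij_betw[OF bij_betw_mult_mod[OF False], of "\<lambda>v. lg v * \<zeta> ^ v"] by simp
  also have "\<dots> = lg t * twisted_sum t"
    unfolding lg_mod primitive_root_power_mod[OF root] lg_mult twisted_sum_def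
    by (simp add: sum_distrib_left mult.assoc)
  finally show ?thesis
    using lg_square[OF False] by (simp flip: mult.assoc)
qed

text \<open>The weights model the Gauss sums of the powers of a character: -1 for the trivial one,
  otherwise a value fixed by the Legendre symbol. The last term corrects \<open>v = 0\<close>, where
  the general expression would give \<open>b * a / 2\<close>.\<close>

lemma sum_two_valued_weights:
  "(\<Sum>v<p. (if v = 0 then - 1 else (b - lg v * w) / 2 * a) * \<zeta> ^ (t * v)) =
     a / 2 * ((if p dvd t then b * of_nat p else 0) - w * lg t * twisted_sum 1) - (1 + b * a / 2)"
proof -
  have "lg 0 = 0"
    by (simp add: Legendre_def)
  then have "(\<Sum>v<p. (if v = 0 then - 1 else (b - lg v * w) / 2 * a) * \<zeta> ^ (t * v)) =
      (\<Sum>v<p. a / 2 * b * \<zeta> ^ (t * v) - a / 2 * w * (lg v * \<zeta> ^ (t * v)) -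
        (if v = 0 then 1 + b * a / 2 else 0))"
    by (intro sum.cong refl) (auto simp: field_simps)
  also have "\<dots> = a / 2 * b * (\<Sum>v<p. \<zeta> ^ (t * v)) - a / 2 * w * twisted_sum t - (1 + b * a / 2)"
    using p_gt_2 by (simp only: sum_subtractf twisted_sum_def flip: sum_distrib_left) simp
  also have "\<dots> = a / 2 * ((if p dvd t then b * of_nat p else 0) - w * lg t * twisted_sum 1)
      - (1 + b * a / 2)"
    unfolding sum_root_powers twisted_sum_eq[of t] by (simp add: algebra_simps)
  finally show ?thesis .
qed

text \<open>
  Summing the squares of all the twisted sums and using orthogonality determines the square of
  a single one. Its sign, which is harder, is not needed.
\<close>
lemma quadratic_gauss_sum_square: "(twisted_sum 1)\<^sup>2 = - of_nat p"
proof -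
  have nonzero: "(\<Sum>t<p. lg t * lg t) = of_nat (p - 1)"
  proof -
    have "(\<Sum>t<p. lg t * lg t) = (\<Sum>t\<in>{..<p} - {0}. 1)"
      by (rule sum.mono_neutral_cong_right)
         (auto simp: Legendre_def cong_0_iff lg_square dest: dvd_imp_le intro!: lg_square)
    then show ?thesis
      using p_gt_2 by simp
  qed
  have "(\<Sum>t<p. twisted_sum t * twisted_sum t) =
        (\<Sum>t<p. \<Sum>v<p. \<Sum>w<p. lg v * lg w * \<zeta> ^ ((v + w) * t))"
    by (simp add: twisted_sum_def sum_product power_add algebra_simps)
  also have "\<dots> = (\<Sum>v<p. \<Sum>w<p. \<Sum>t<p. lg v * lg w * \<zeta> ^ ((v + w) * t))"
    by (subst sum.swap, rule sum.cong, simp, rule sum.swap)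
  also have "\<dots> = (\<Sum>v<p. \<Sum>w<p. if p dvd v + w then - of_nat p * (lg v * lg v) else 0)"
  proof (intro sum.cong refl)
    fix v w
    \<comment> \<open>The condition means that \<open>w\<close> is \<open>- v\<close> modulo
      \<open>p\<close>; as -1 is a nonresidue, this is where the minus sign of the result
      arises.\<close>
    have "lg w = - lg v" if "p dvd v + w"
    proof -
      have "int p dvd int w - - int v"
        using that by (metis add.commute diff_minus_eq_add of_nat_add of_nat_dvd_iff)
      then have "[int w = - int v] (mod int p)"
        by (simp add: cong_iff_dvd_diff)
      then show ?thesis
        using Legendre_cong Legendre_uminus[OF prime_p p_gt_2 p_mod_4] by (metis of_int_minus)
    qed
    then show "(\<Sum>t<p. lg v * lg w * \<zeta> ^ ((v + w) * t)) =
        (if p dvd v + w then - of_nat p * (lg v * lg v) else 0)"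
      by (simp add: sum_root_powers flip: sum_distrib_left)
  qed
  also have "\<dots> = (\<Sum>v<p. - of_nat p * (lg v * lg v))"
  proof (rule sum.cong)
    fix v assume v: "v \<in> {..<p}"
    have "p dvd v + w \<longleftrightarrow> w = (p - v) mod p" if "w < p" for w
      using dvd_add_iff_eq_complement[OF that, of v] v by simp
    then have "(\<Sum>w<p. if p dvd v + w then - of_nat p * (lg v * lg v) else 0) =
               (\<Sum>w<p. if w = (p - v) mod p then - of_nat p * (lg v * lg v) else 0)"
      by (intro sum.cong) auto
    then show "(\<Sum>w<p. if p dvd v + w then - of_nat p * (lg v * lg v) else 0) =
               - of_nat p * (lg v * lg v)"
      using p_gt_2 by simp
  qed simp
  also have "\<dots> = - of_nat p * of_nat (p - 1)"
    unfolding nonzero[symmetric] by (simp only: sum_distrib_left)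
  finally have "(\<Sum>t<p. twisted_sum t * twisted_sum t) = - of_nat p * of_nat (p - 1)" .
  \<comment> \<open>The same sum evaluated a second time, through \<open>twisted_sum_eq\<close>; the
    common factor \<open>p - 1\<close> then cancels.\<close>
  moreover have "(\<Sum>t<p. twisted_sum t * twisted_sum t) =
      (\<Sum>t<p. lg t * lg t) * (twisted_sum 1)\<^sup>2"
    unfolding sum_distrib_right
    by (intro sum.cong refl, subst (1 2) twisted_sum_eq) (simp add: power2_eq_square)
  ultimately have "of_nat (p - 1) * (twisted_sum 1)\<^sup>2 = of_nat (p - 1) * (- of_nat p)"
    unfolding nonzero by (simp add: mult.commute)
  moreover have "(of_nat (p - 1) :: complex) \<noteq> 0"
    using p_gt_2 by (simp only: of_nat_eq_0_iff)
  ultimately show ?thesis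
    by (metis mult_cancel_left)
qed

end

section \<open>The cyclic subgroup of index two in the units modulo a prime power\<close>

lemma totient_prime_power_odd_half:
  fixes p m :: nat
  assumes "prime p" and "[p = 3] (mod 4)" and "m \<ge> 1" and "2 * f = totient (p ^ m)"
  shows "odd f"
proof -
  obtain k where k: "p - 1 = 2 * (2 * k + 1)"
    using half_pred_odd assms(2) by blast
  have "totient (p ^ m) = p ^ (m - 1) * (p - 1)"
    using assms by (intro totient_prime_power) auto
  then have "f = p ^ (m - 1) * (2 * k + 1)"
    using assms(4) k by simp
  moreover have "odd p"
    using k by presburger
  ultimately show ?thesis by simp
qed

text \<open>
  The powers of \<open>x\<close> are squares because the order of \<open>x\<close> is odd, and \<open>- 1\<close>
  is not a square. So the powers of \<open>x\<close> and their negatives are disjoint sets, which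
  together exhaust the units because each of them is half as large.
\<close>
lemma unit_is_power_or_minus_power:
  fixes p m x j :: nat
  assumes p: "prime p" "p > 2" "[p = 3] (mod 4)" and m: "m \<ge> 1"
    and x: "coprime (p ^ m) x" and half: "2 * ord (p ^ m) x = totient (p ^ m)"
    and j: "\<not> p dvd j"
  shows "(Legendre (int j) (int p) = 1 \<and> (\<exists>t. [j = x ^ t] (mod p ^ m))) \<or>
         (Legendre (int j) (int p) = - 1 \<and> (\<exists>t. [j + x ^ t = 0] (mod p ^ m)))"
proof -
  define N where "N = p ^ m"
  define f where "f = ord N x"
  have N: "N > 2"
    using p(2) m self_le_power[of p m] by (simp add: N_def)
  have "p dvd N"
    using m by (simp add: N_def)
  have "odd f"
    using totient_prime_power_odd_half[of p m f] p m half by (simp add: f_def N_def)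
  have xf: "[x ^ f = 1] (mod N)"
    unfolding f_def by (rule ord)
  have lg_N: "Legendre (int a) (int p) = Legendre (int b) (int p)" if "[a = b] (mod N)" for a b
  proof -
    have "[a = b] (mod p)"
      using that \<open>p dvd N\<close> cong_dvd_modulus_nat by blast
    then show ?thesis
      by (intro Legendre_cong) (simp add: cong_int_iff)
  qed
  \<comment> \<open>A symbol whose \<open>f\<close>-th power is 1 is itself 1, because
    \<open>f\<close> is odd.\<close>
  have lg_x: "Legendre (int x) (int p) = 1"
  proof -
    have "Legendre (int x) (int p) ^ f = 1"
      using lg_N[OF xf] Legendre_power[OF p(1,2), of "int x" f] Legendre_1[OF p(2)] by simp
    then show ?thesis
      using Legendre_range[of "int x" "int p"] \<open>odd f\<close> by (auto simp: power_0_left split: if_splits)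
  qed
  have lg_power: "Legendre (int (x ^ t)) (int p) = 1" for t
    using Legendre_power[OF p(1,2), of "int x" t] lg_x by simp
  define H where "H = (\<lambda>t. x ^ t mod N) ` {..<f}"
  define H' where "H' = (\<lambda>h. N - h) ` H"
  have "coprime x N"
    using x by (simp add: N_def coprime_commute)
  then have cop: "coprime (x ^ t mod N) N" for t
    using N by simp
  have pos: "0 < n" if "coprime n N" for n
    using that N by (intro gr0I) auto
  have H_bounds: "0 < h \<and> h < N \<and> coprime h N" if "h \<in> H" for h
    using that cop pos N by (auto simp: H_def)
  have lg_H: "Legendre (int h) (int p) = 1" if "h \<in> H" for h
    using that lg_N[of "x ^ t mod N" "x ^ t" for t] lg_power by (auto simp: H_def cong_def)
  have lg_H': "Legendre (int h) (int p) = - 1" if h: "h \<in> H'" for h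
  proof -
    obtain h' where h': "h' \<in> H" "h = N - h'"
      using h by (auto simp: H'_def)
    then have "[int h = - int h'] (mod int p)"
      using H_bounds[of h'] \<open>p dvd N\<close> by (simp add: of_nat_diff cong_iff_dvd_diff)
    then show ?thesis
      using Legendre_cong Legendre_uminus[OF p] lg_H[OF h'(1)] by metis
  qed
  have "card H = f"
  proof -
    have "inj_on (\<lambda>t. x ^ t mod N) {..<f}"
    proof (rule inj_onI)
      fix s t assume "s \<in> {..<f}" "t \<in> {..<f}" "x ^ s mod N = x ^ t mod N"
      moreover from this have "[s = t] (mod f)"
        unfolding f_def using order_divides_expdiff[of N x s t] x by (simp add: N_def cong_def)
      ultimately show "s = t"
        by (simp add: cong_def)
    qed
    then show ?thesis
      by (simp add: H_def card_image)
  qed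
  moreover have "card H' = card H"
    unfolding H'_def
  proof (rule card_image, rule inj_onI)
    fix g h assume "g \<in> H" "h \<in> H" "N - g = N - h"
    then show "g = h"
      using H_bounds[of g] H_bounds[of h] by linarith
  qed
  moreover have "H \<inter> H' = {}"
    using lg_H lg_H' by fastforce
  moreover have "finite H" "finite H'"
    by (auto simp: H_def H'_def)
  ultimately have "card (H \<union> H') = totient N"
    using half by (simp add: card_Un_disjoint f_def N_def)
  moreover have "H \<union> H' \<subseteq> totatives N"
  proof
    fix h assume "h \<in> H \<union> H'"
    then show "h \<in> totatives N"
    proof
      assume "h \<in> H'"
      then obtain h' where h': "h' \<in> H" "h = N - h'"
        by (auto simp: H'_def)
      have "coprime (N - h') N"
        using H_bounds[OF h'(1)] by (metis coprime_iff_gcd_eq_1 gcd_diff2_nat less_imp_le_nat)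
      then show ?thesis
        using h' H_bounds[OF h'(1)] by (simp add: totatives_def)
    qed (use H_bounds in \<open>auto simp: totatives_def less_imp_le\<close>)
  qed
  ultimately have units: "H \<union> H' = totatives N"
    by (intro card_subset_eq) (auto simp: totient_def)
  have "coprime j N"
    using prime_imp_coprime[OF p(1) j] by (simp add: N_def coprime_commute)
  then have "coprime (j mod N) N"
    using N by simp
  moreover from this have "j mod N > 0"
    by (rule pos)
  ultimately have "j mod N \<in> H \<union> H'"
    using N unfolding units by (simp add: totatives_def less_imp_le)
  moreover have lg_j: "Legendre (int (j mod N)) (int p) = Legendre (int j) (int p)"
    by (rule lg_N) (simp add: cong_def)
  ultimately show ?thesis
  proof (elim UnE)
    assume jH: "j mod N \<in> H"
    then obtain t where "j mod N = x ^ t mod N"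
      by (auto simp: H_def)
    then have "[j = x ^ t] (mod p ^ m)"
      by (simp add: N_def cong_def)
    then show ?thesis
      using lg_H[OF jH] lg_j by auto
  next
    assume jH: "j mod N \<in> H'"
    then obtain t where t: "j mod N = N - x ^ t mod N"
      by (auto simp: H'_def H_def)
    have "(j + x ^ t) mod N = (j mod N + x ^ t mod N) mod N"
      by (simp add: mod_add_eq)
    also have "\<dots> = 0"
      unfolding t using N by simp
    finally have "[j + x ^ t = 0] (mod p ^ m)"
      by (simp add: N_def cong_def)
    then show ?thesis
      using lg_H'[OF jH] lg_j by auto
  qed
qed

text \<open>With \<open>c\<^sup>2 = b\<^sup>2\<close> the equation reads
  \<open>b\<^sup>2 * (1 + r) = 4 * p ^ h\<close>. As \<open>b\<close> is prime to \<open>p\<close>,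
  its square divides 4, which leaves only 1 and 2 for its absolute value.\<close>

lemma unit_coeffs_of_norm_equation:
  fixes b c :: int and p r h :: nat
  assumes "prime p" and "[r = 3] (mod 4)"
    and "\<not> [b = 0] (mod int p)" and norm: "b\<^sup>2 + int r * c\<^sup>2 = 4 * int p ^ h"
    and "b = c \<or> b = - c"
  shows "b \<in> {1, - 1} \<and> c \<in> {1, - 1}"
proof -
  have "c\<^sup>2 = b\<^sup>2"
    using assms(5) by auto
  then have eq: "b\<^sup>2 * (1 + int r) = 4 * int p ^ h"
    using norm by (simp add: algebra_simps)
  have "\<not> int p dvd b"
    using assms(3) by (simp add: cong_0_iff)
  then have "coprime (int p) b"
    using assms(1) by (intro prime_imp_coprime) auto
  then have "coprime (b\<^sup>2) (int p ^ h)"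
    by (simp add: coprime_commute)
  then have "b\<^sup>2 dvd 4"
    using eq by (metis coprime_dvd_mult_left_iff dvd_triv_left)
  then have "b\<^sup>2 \<le> 4"
    by (rule zdvd_imp_le) simp
  then have "\<bar>b\<bar> \<le> 2"
    using abs_le_square_iff[of b 2] by simp
  moreover have "b \<noteq> 0"
    using \<open>\<not> int p dvd b\<close> by auto
  \<comment> \<open>Here \<open>p ^ h = 1 + r\<close> would be even, forcing \<open>p = 2\<close>,
    which divides \<open>b\<close>.\<close>
  moreover have "\<bar>b\<bar> \<noteq> 2"
  proof
    assume "\<bar>b\<bar> = 2"
    then have "b\<^sup>2 = 2\<^sup>2"
      using power2_abs[of b] by simp
    then have "int p ^ h = 1 + int r"
      using eq by simp
    then have "p ^ h = 1 + r"
      by (metis of_nat_1 of_nat_add of_nat_eq_iff of_nat_power)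
    moreover have "r mod 4 = 3"
      using assms(2) by (simp add: cong_def)
    ultimately have "even (p ^ h)"
      by presburger
    then have "p = 2"
      using assms(1) by (metis even_power primes_dvd_imp_eq two_is_prime_nat)
    then show False
      using \<open>\<bar>b\<bar> = 2\<close> \<open>\<not> int p dvd b\<close> by (metis dvd_abs_iff dvd_refl of_nat_numeral)
  qed
  ultimately have "b = 1 \<or> b = - 1"
    by linarith
  then show ?thesis
    using assms(5) by auto
qed

section \<open>Gauss sums and cyclotomic classes\<close>

lemma primitive_root_of_unity_exp:
  assumes "n > 0"
  shows "primitive_root_of_unity n (exp (2 * of_real pi * \<i> / of_nat n))"
proof -
  define z where "z = exp (2 * of_real pi * \<i> / of_nat n)"
  have power: "z ^ k = cis (2 * pi * real k / real n)" for k
    by (simp add: z_def cis_conv_exp mult_ac flip: exp_of_nat_mult)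
  have "z ^ n = 1"
    using assms by (simp add: power)
  moreover have "z ^ k \<noteq> 1" if "0 < k" "k < n" for k
    using bij_betw_roots_unity[OF assms] that assms
    unfolding power bij_betw_def inj_on_def
    by (metis (no_types, lifting) cis_zero div_0 lessThan_iff mult_zero_right neq0_conv of_nat_0)
  ultimately show ?thesis
    using assms by (simp add: primitive_root_of_unity_def flip: z_def)
qed

lemma primitive_root_power_eq_iff:
  assumes "primitive_root_of_unity n z"
  shows "z ^ k = z ^ l \<longleftrightarrow> [k = l] (mod n)"
proof
  have *: "[k = l] (mod n)" if "z ^ k = z ^ l" "k \<le> l" for k l
  proof -
    have "z \<noteq> 0"
      using assms by (auto simp: primitive_root_of_unity_def power_0_left)
    moreover have "z ^ l = z ^ k * z ^ (l - k)"
      using that(2) by (simp flip: power_add)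
    ultimately have "z ^ (l - k) = 1"
      using that by simp
    then have "[l = k] (mod n)"
      using that by (simp add: primitive_root_power_eq_1_iff[OF assms] cong_altdef_nat)
    then show ?thesis
      by (rule cong_sym)
  qed
  assume "z ^ k = z ^ l"
  then show "[k = l] (mod n)"
    using *[of k l] *[of l k] cong_sym[of l k n] by (metis nat_le_linear)
next
  assume "[k = l] (mod n)"
  then show "z ^ k = z ^ l"
    using primitive_root_power_mod[OF assms] unfolding cong_def by metis
qed

text \<open>Division of the index by \<open>n\<close> with quotient \<open>u\<close> and remainder
  \<open>v\<close>.\<close>

lemma sum_lessThan_mult:
  fixes F :: "nat \<Rightarrow> 'b::comm_monoid_add"
  shows "(\<Sum>j<m * n. F j) = (\<Sum>v<n. \<Sum>u<m. F (u * n + v))"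
proof -
  have "(\<Sum>j<m * n. F j) = (\<Sum>u<m. \<Sum>j\<in>{u * n..<u * n + n}. F j)"
    by (rule sum.nat_group[symmetric])
  also have "\<dots> = (\<Sum>u<m. \<Sum>v<n. F (u * n + v))"
  proof (rule sum.cong)
    fix u
    show "(\<Sum>j\<in>{u * n..<u * n + n}. F j) = (\<Sum>v<n. F (u * n + v))"
      by (rule sum.reindex_bij_witness[of _ "\<lambda>v. u * n + v" "\<lambda>j. j - u * n"]) auto
  qed simp
  finally show ?thesis
    by (subst sum.swap)
qed

context
  fixes \<gamma> :: "'a::{field,finite}" and chi :: "'a \<Rightarrow> complex" and N :: nat
  assumes primitive: "primitive_element \<gamma>" and chi: "multiplicative_character chi"
    and chi_root: "primitive_root_of_unity N (chi \<gamma>)"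
begin

private lemma chi_nonzero: "x \<noteq> 0 \<Longrightarrow> chi x \<noteq> 0"
  and chi_mult: "chi (x * y) = chi x * chi y"
  using chi by (auto simp: multiplicative_character_def)

private lemma chi_one: "chi 1 = 1"
  using chi_mult[of 1 1] chi_nonzero[of 1] by simp

private lemma chi_power: "chi (x ^ k) = chi x ^ k"
  by (induction k) (simp_all add: chi_one chi_mult)

private lemma generator_power:
  assumes "x \<noteq> 0"
  obtains k where "x = \<gamma> ^ k"
  using primitive assms unfolding primitive_element_def by blast

private lemma generator_nonzero: "\<gamma> ^ k \<noteq> 0"
  using primitive unfolding primitive_element_def by blast

private lemma chi_power_order:
  assumes "x \<noteq> 0"
  shows "chi x ^ N = 1"
proof -
  obtain k where "x = \<gamma> ^ k"
    using assms by (rule generator_power)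
  moreover have "chi \<gamma> ^ N = 1"
    using chi_root by (simp add: primitive_root_of_unity_def)
  ultimately show ?thesis
    by (metis chi_power power_commutes power_mult power_one mult.commute)
qed

private lemma norm_chi:
  assumes "x \<noteq> 0"
  shows "norm (chi x) = 1"
proof -
  have "N > 0"
    using chi_root by (simp add: primitive_root_of_unity_def)
  then show ?thesis
    using chi_power_order[OF assms] power_eq_1_iff by blast
qed

text \<open>The value at -1 has square 1 and odd power 1, so it is 1. This yields the symmetry of
  \<open>D\<close> and of the Gauss sums under conjugation.\<close>

lemma multiplicative_character_uminus:
  assumes "odd N"
  shows "chi (- x) = chi x"
proof -
  obtain k where "N = 2 * k + 1"
    using assms oddE by blast
  moreover have "chi (- 1) ^ 2 = 1"
    using chi_mult[of "- 1" "- 1"] chi_one by (simp add: power2_eq_square)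
  ultimately have "chi (- 1) ^ N = chi (- 1)"
    by (simp add: power_mult)
  then have "chi (- 1) = 1"
    using chi_power_order[of "- 1"] by simp
  then show ?thesis
    using chi_mult[of "- 1" x] by simp
qed

text \<open>The classes are the fibres of \<open>chi\<close> on nonzero elements: a power
  \<open>\<gamma> ^ s\<close> lies in the kernel iff \<open>N\<close> divides
  \<open>s\<close>.\<close>

lemma cyclotomic_class_eq: "cyclotomic_class \<gamma> N i = {x. x \<noteq> 0 \<and> chi x = chi \<gamma> ^ i}"
proof (intro equalityI subsetI)
  fix x assume "x \<in> cyclotomic_class \<gamma> N i"
  then obtain k where x: "x = \<gamma> ^ i * (\<gamma> ^ N) ^ k"
    by (auto simp: cyclotomic_class_def)
  then have "chi x = chi \<gamma> ^ i"
    using chi_power_order[OF generator_nonzero[of 1]] by (simp add: chi_mult chi_power)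
  then show "x \<in> {x. x \<noteq> 0 \<and> chi x = chi \<gamma> ^ i}"
    using x generator_nonzero[of 1] by simp
next
  fix x assume "x \<in> {x. x \<noteq> 0 \<and> chi x = chi \<gamma> ^ i}"
  then have x: "x \<noteq> 0" "chi x = chi \<gamma> ^ i"
    by auto
  then have "x / \<gamma> ^ i \<noteq> 0"
    using generator_nonzero by simp
  then obtain s where s: "x / \<gamma> ^ i = \<gamma> ^ s"
    by (rule generator_power)
  then have eq: "x = \<gamma> ^ i * \<gamma> ^ s"
    using generator_nonzero[of i] by (simp add: field_simps)
  then have "chi \<gamma> ^ i * chi \<gamma> ^ s = chi \<gamma> ^ i * 1"
    using x by (simp add: chi_mult chi_power)
  then have "chi \<gamma> ^ s = 1"
    using chi_nonzero[OF generator_nonzero[of 1]] by simp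
  then obtain k where "s = N * k"
    using primitive_root_power_eq_1_iff[OF chi_root] by blast
  then show "x \<in> cyclotomic_class \<gamma> N i"
    using eq by (auto simp: cyclotomic_class_def power_mult)
qed

section \<open>Gauss sums of the powers of a multiplicative character\<close>

context
  fixes \<psi> :: "'a \<Rightarrow> complex"
  assumes psi_add: "\<And>x y. \<psi> (x + y) = \<psi> x * \<psi> y"
    and psi_norm: "\<And>x. norm (\<psi> x) = 1"
    and psi_nontrivial: "\<exists>x. \<psi> x \<noteq> 1"
begin

text \<open>Excluding \<open>x = 0\<close> matters for \<open>j = 0\<close>, since
  \<open>chi 0 ^ 0\<close> is 1. Inverse characters are covered by the exponent
  \<open>N - 1\<close>.\<close>

definition gauss_power_sum :: "nat \<Rightarrow> complex" where
  "gauss_power_sum j = (\<Sum>x\<in>UNIV - {0}. chi x ^ j * \<psi> x)"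

lemma gauss_power_sum_0: "gauss_power_sum 0 = - 1"
proof -
  have "\<psi> 0 = 1"
    using character_orthogonality[OF psi_add psi_norm psi_nontrivial]
      psi_add[of 0 0] psi_norm[of 0] by (metis add.right_neutral mult_cancel_left2 norm_zero zero_neq_one)
  then show ?thesis
    using sum_character[OF psi_add psi_norm psi_nontrivial]
    by (simp add: gauss_power_sum_def sum_diff1)
qed

lemma gauss_power_sum_cong:
  assumes "[j = k] (mod N)"
  shows "gauss_power_sum j = gauss_power_sum k"
  unfolding gauss_power_sum_def
proof (rule sum.cong)
  fix x :: 'a assume "x \<in> UNIV - {0}"
  then have "chi x ^ N = 1"
    using chi_power_order by simp
  then have "chi x ^ n = chi x ^ (n mod N)" for n
    by (metis mult_div_mod_eq mult_1 power_add power_mult power_one)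
  then show "chi x ^ j * \<psi> x = chi x ^ k * \<psi> x"
    using assms unfolding cong_def by metis
qed simp

lemma gauss_power_sum_inverse:
  "(\<Sum>x\<in>UNIV - {0}. inverse (chi x) * \<psi> x) = gauss_power_sum (N - 1)"
  unfolding gauss_power_sum_def
proof (rule sum.cong)
  fix x :: 'a assume "x \<in> UNIV - {0}"
  then have x: "x \<noteq> 0" by simp
  have "N > 0"
    using chi_root by (simp add: primitive_root_of_unity_def)
  then have "chi x * chi x ^ (N - 1) = 1"
    using chi_power_order[OF x] by (metis power_eq_if less_not_refl)
  then show "inverse (chi x) * \<psi> x = chi x ^ (N - 1) * \<psi> x"
    by (simp add: inverse_unique)
qed simp

text \<open>Substituting \<open>x ^ p\<close> for \<open>x\<close> leaves \<psi> unchanged and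
  multiplies the exponent of \<open>chi\<close> by \<open>p\<close>.\<close>

lemma gauss_power_sum_frobenius:
  assumes "\<And>x. \<psi> (x ^ p) = \<psi> x" and "bij (\<lambda>x :: 'a. x ^ p)" and "p > 0"
  shows "gauss_power_sum (p ^ t * j) = gauss_power_sum j"
proof (induction t)
  case (Suc t)
  have bij: "bij_betw (\<lambda>x :: 'a. x ^ p) (UNIV - {0}) (UNIV - {0})"
    using image_set_diff[OF bij_is_inj[OF assms(2)], of UNIV "{0}"] bij_is_surj[OF assms(2)] assms(3)
      inj_on_subset[OF bij_is_inj[OF assms(2)], of "UNIV - {0}"]
    by (simp add: bij_betw_def power_0_left)
  have "gauss_power_sum (p ^ t * j) = (\<Sum>x\<in>UNIV - {0}. chi (x ^ p) ^ (p ^ t * j) * \<psi> (x ^ p))"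
    unfolding gauss_power_sum_def by (rule sum.reindex_bij_betw[OF bij, symmetric])
  also have "\<dots> = gauss_power_sum (p ^ Suc t * j)"
    by (simp add: gauss_power_sum_def assms(1) chi_power mult.assoc flip: power_mult)
  finally show ?case
    using Suc.IH by simp
qed simp

text \<open>Conjugation inverts \<open>chi\<close> and replaces \<open>x\<close> by
  \<open>- x\<close> in \<psi>; the latter is undone by a substitution because \<open>chi\<close> is
  even.\<close>

lemma gauss_power_sum_cnj:
  assumes "odd N" and "[j + k = 0] (mod N)"
  shows "gauss_power_sum j = cnj (gauss_power_sum k)"
proof -
  have cnj_chi: "cnj (chi x) ^ k = chi x ^ j" if "x \<noteq> 0" for x
  proof -
    have "chi x * cnj (chi x) = 1"
      using complex_norm_square[of "chi x"] norm_chi[OF that] by simp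
    then have "chi x ^ k * cnj (chi x) ^ k = 1"
      by (metis power_mult_distrib power_one)
    moreover obtain l where "j + k = N * l"
      using assms(2) by (auto simp: cong_0_iff)
    then have "chi x ^ k * chi x ^ j = 1"
      using chi_power_order[OF that] by (metis add.commute power_add power_mult power_one)
    ultimately show ?thesis
      by (metis mult_cancel_left mult_eq_0_iff zero_neq_one)
  qed
  have "cnj (gauss_power_sum k) = (\<Sum>x\<in>UNIV - {0}. chi x ^ j * \<psi> (- x))"
    by (simp add: gauss_power_sum_def cnj_chi cnj_character[OF psi_add psi_norm psi_nontrivial])
  also have "\<dots> = gauss_power_sum j"
    unfolding gauss_power_sum_def
    by (rule sum.reindex_bij_witness[of _ uminus uminus])
       (auto simp: multiplicative_character_uminus[OF assms(1)])
  finally show ?thesis by simp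
qed

lemma sum_chi_translate:
  "(\<Sum>x\<in>UNIV - {0}. chi x ^ j * \<psi> (\<gamma> ^ k * x)) = inverse (chi \<gamma>) ^ (k * j) * gauss_power_sum j"
proof -
  have "(\<Sum>x\<in>UNIV - {0}. chi x ^ j * \<psi> (\<gamma> ^ k * x)) =
        (\<Sum>x\<in>UNIV - {0}. inverse (chi \<gamma>) ^ (k * j) * (chi x ^ j * \<psi> x))"
  proof (rule sum.reindex_bij_witness[of _ "\<lambda>x. x / \<gamma> ^ k" "\<lambda>x. \<gamma> ^ k * x"])
    fix x :: 'a assume "x \<in> UNIV - {0}"
    show "inverse (chi \<gamma>) ^ (k * j) * (chi (\<gamma> ^ k * x) ^ j * \<psi> (\<gamma> ^ k * x)) =
          chi x ^ j * \<psi> (\<gamma> ^ k * x)"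
      using chi_nonzero[OF generator_nonzero[of 1]]
      by (simp add: chi_mult chi_power power_mult_distrib power_inverse flip: power_mult)
  qed (use generator_nonzero in auto)
  then show ?thesis
    by (simp add: gauss_power_sum_def sum_distrib_left)
qed

section \<open>Character sums over the union of the first \<open>M\<close> cyclotomic
  classes\<close>

context
  fixes M r :: nat and D :: "'a set"
  assumes N_eq: "N = M * r"
    and D_def: "D = {x. x \<noteq> 0 \<and> (\<exists>i<M. chi x = chi \<gamma> ^ i)}"
begin

private lemma inverse_root: "primitive_root_of_unity N (inverse (chi \<gamma>))"
  using chi_root by (auto simp: primitive_root_of_unity_def power_inverse)

private lemma pos: "M > 0" "r > 0" "M \<le> N"
proof -
  have "N > 0"
    using chi_root by (simp add: primitive_root_of_unity_def)
  then show "M > 0" "r > 0" "M \<le> N"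
    using N_eq by auto
qed

text \<open>The sum over \<open>j\<close> detects \<open>chi x = chi \<gamma> ^ i\<close>. At most
  one \<open>i < M\<close> satisfies this, because \<open>M \<le> N\<close> makes these indices
  distinct modulo \<open>N\<close>.\<close>

private lemma indicator_D:
  assumes "x \<noteq> 0"
  shows "(\<Sum>i<M. \<Sum>j<N. (inverse (chi \<gamma>) ^ i * chi x) ^ j) = (if x \<in> D then of_nat N else 0)"
proof -
  obtain a where a: "x = \<gamma> ^ a"
    using assms by (rule generator_power)
  have eq: "chi x = chi \<gamma> ^ i \<longleftrightarrow> i = a mod N" if "i < M" for i
    using that pos(3) unfolding a chi_power primitive_root_power_eq_iff[OF chi_root]
    by (auto simp: cong_def)
  have "(\<Sum>j<N. (inverse (chi \<gamma>) ^ i * chi x) ^ j) = (if i = a mod N then of_nat N else 0)"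
    if "i < M" for i
  proof -
    have nz: "chi \<gamma> ^ i \<noteq> 0"
      using chi_nonzero[OF generator_nonzero[of 1]] by simp
    have "inverse (chi \<gamma>) ^ N = 1"
      using inverse_root by (simp add: primitive_root_of_unity_def)
    then have "(inverse (chi \<gamma>) ^ i * chi x) ^ N = 1"
      using chi_power_order[OF assms]
      by (metis mult_1 power_commuting_commutes power_mult power_mult_distrib power_one mult.commute)
    then have "(\<Sum>j<N. (inverse (chi \<gamma>) ^ i * chi x) ^ j) =
               (if inverse (chi \<gamma>) ^ i * chi x = 1 then of_nat N else 0)"
      by (rule sum_powers_root_of_unity)
    also have "inverse (chi \<gamma>) ^ i * chi x = 1 \<longleftrightarrow> chi x = chi \<gamma> ^ i"
      using nz by (auto simp: power_inverse field_simps)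
    finally show ?thesis
      using eq[OF that] by simp
  qed
  then have "(\<Sum>i<M. \<Sum>j<N. (inverse (chi \<gamma>) ^ i * chi x) ^ j) =
             (\<Sum>i<M. if i = a mod N then of_nat N else 0)"
    by simp
  also have "\<dots> = (if a mod N < M then of_nat N else 0)"
    by simp
  also have "a mod N < M \<longleftrightarrow> x \<in> D"
    using assms eq by (auto simp: D_def)
  finally show ?thesis .
qed

text \<open>Expand the indicator of \<open>D\<close> in powers of \<open>chi\<close> and sum over
  the field first; each inner sum is a translated Gauss sum.\<close>

lemma character_sum_D_eq_gauss:
  "of_nat N * (\<Sum>d\<in>D. \<psi> (\<gamma> ^ k * d)) =
     (\<Sum>j<N. gauss_power_sum j * (\<Sum>i<M. inverse (chi \<gamma>) ^ ((k + i) * j)))"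
proof -
  let ?W = "inverse (chi \<gamma>)"
  have "of_nat N * (\<Sum>d\<in>D. \<psi> (\<gamma> ^ k * d)) =
        (\<Sum>x\<in>UNIV - {0}. (if x \<in> D then of_nat N else 0) * \<psi> (\<gamma> ^ k * x))"
    unfolding sum_distrib_left
    by (rule sum.mono_neutral_cong_left) (auto simp: D_def)
  also have "\<dots> = (\<Sum>x\<in>UNIV - {0}. \<Sum>i<M. \<Sum>j<N. ?W ^ (i * j) * (chi x ^ j * \<psi> (\<gamma> ^ k * x)))"
  proof (rule sum.cong)
    fix x :: 'a assume "x \<in> UNIV - {0}"
    then have "(if x \<in> D then of_nat N else 0) = (\<Sum>i<M. \<Sum>j<N. (?W ^ i * chi x) ^ j)"
      using indicator_D by simp
    then show "(if x \<in> D then of_nat N else 0) * \<psi> (\<gamma> ^ k * x) =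
        (\<Sum>i<M. \<Sum>j<N. ?W ^ (i * j) * (chi x ^ j * \<psi> (\<gamma> ^ k * x)))"
      by (simp only: sum_distrib_right power_mult_distrib mult.assoc power_mult)
  qed simp
  also have "\<dots> = (\<Sum>j<N. \<Sum>i<M. \<Sum>x\<in>UNIV - {0}. ?W ^ (i * j) * (chi x ^ j * \<psi> (\<gamma> ^ k * x)))"
    by (subst sum.swap, subst (2) sum.swap, subst sum.swap) simp
  also have "\<dots> = (\<Sum>j<N. \<Sum>i<M. ?W ^ (i * j) * (?W ^ (k * j) * gauss_power_sum j))"
    by (simp add: sum_chi_translate flip: sum_distrib_left)
  finally show ?thesis
    by (simp add: sum_distrib_left power_add distrib_left distrib_right mult_ac)
qed

lemma D_uminus:
  assumes "odd N" and "x \<in> D"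
  shows "- x \<in> D"
  using assms(2) multiplicative_character_uminus[OF assms(1)] by (simp add: D_def)

lemma one_in_D: "1 \<in> D"
  using pos chi_one by (auto simp: D_def intro!: exI[of _ 0])

text \<open>The class of index \<open>M\<close> comes just after those in \<open>D\<close>. With
  \<open>one_in_D\<close> this keeps the Cayley graph from being complete or edgeless.\<close>

lemma generator_power_notin_D:
  assumes "r > 1"
  shows "\<gamma> ^ M \<notin> D"
proof
  assume "\<gamma> ^ M \<in> D"
  then obtain i where i: "i < M" "[M = i] (mod N)"
    by (auto simp: D_def chi_power primitive_root_power_eq_iff[OF chi_root])
  moreover have "M < N"
    using assms pos by (simp add: N_eq)
  ultimately show False
    by (simp add: cong_def)
qed

lemma primitive_root_inverse_power: "primitive_root_of_unity r (inverse (chi \<gamma>) ^ M)"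
  unfolding primitive_root_of_unity_def
  using primitive_root_power_eq_1_iff[OF inverse_root] pos
  by (auto simp: N_eq dest: dvd_imp_le simp flip: power_mult)

text \<open>
  The geometric sum over \<open>i\<close> vanishes at every nonzero multiple \<open>j\<close> of \<open>r\<close>, so the Gauss
  sums of the characters that are not injective on the \<open>N\<close>-th roots of unity can be
  replaced by anything. Once they depend only on \<open>j\<close> modulo \<open>r\<close>, the sum over \<open>j\<close>
  collapses.
\<close>
lemma character_sum_D:
  assumes K: "\<And>j. \<not> r dvd j \<Longrightarrow> gauss_power_sum j = K (j mod r)" and K0: "K 0 = - 1"
  obtains t where
    "of_nat r * (\<Sum>d\<in>D. \<psi> (\<gamma> ^ k * d)) = (\<Sum>v<r. K v * (inverse (chi \<gamma>) ^ M) ^ (t * v))"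
    and "\<And>s. k = M * s \<Longrightarrow> t = s"
proof -
  let ?W = "inverse (chi \<gamma>)"
  define T where "T j = (\<Sum>i<M. ?W ^ ((k + i) * j))" for j
  have W_eq: "?W ^ n = 1 \<longleftrightarrow> N dvd n" for n
    by (rule primitive_root_power_eq_1_iff[OF inverse_root])
  \<comment> \<open>The unique index below \<open>M\<close> that completes \<open>k\<close> to a
    multiple of \<open>M\<close>; the quotient \<open>t\<close> becomes the frequency in the
    collapsed sum.\<close>
  define i0 where "i0 = (M - k mod M) mod M"
  have i0: "i0 < M" "M dvd k + i0"
    using dvd_add_iff_eq_complement[of i0 M k] pos by (auto simp: i0_def)
  then obtain t where t: "k + i0 = M * t"
    by blast
  have "gauss_power_sum j * T j = K (j mod r) * T j" if "j < N" for j
  proof (cases "r dvd j \<and> j \<noteq> 0")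
    case True
    then obtain l where l: "j = r * l"
      by blast
    have "T j = ?W ^ (k * j) * (\<Sum>i<M. (?W ^ j) ^ i)"
      by (simp add: T_def distrib_left distrib_right power_add sum_distrib_left mult_ac
          flip: power_mult)
    also have "(\<Sum>i<M. (?W ^ j) ^ i) = 0"
    proof -
      have "(?W ^ j) ^ M = 1" "?W ^ j \<noteq> 1"
        using True that by (auto simp: W_eq l N_eq dest: dvd_imp_le simp flip: power_mult)
      then show ?thesis
        using sum_powers_root_of_unity by simp
    qed
    finally show ?thesis by simp
  next
    case False
    then show ?thesis
      using K[of j] K0 gauss_power_sum_0 by (cases "j = 0") auto
  qed
  then have "of_nat N * (\<Sum>d\<in>D. \<psi> (\<gamma> ^ k * d)) = (\<Sum>j<N. K (j mod r) * T j)"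
    unfolding character_sum_D_eq_gauss T_def[symmetric]
    by (intro sum.cong refl) (simp only: lessThan_iff)
  also have "\<dots> = (\<Sum>v<r. \<Sum>u<M. K v * T (u * r + v))"
    unfolding N_eq sum_lessThan_mult by (intro sum.cong refl) simp
  also have "\<dots> = (\<Sum>v<r. of_nat M * (K v * (?W ^ M) ^ (t * v)))"
  proof (rule sum.cong)
    fix v
    have "(\<Sum>u<M. T (u * r + v)) =
          (\<Sum>i<M. \<Sum>u<M. ?W ^ ((k + i) * v) * (?W ^ ((k + i) * r)) ^ u)"
      unfolding T_def
      by (subst sum.swap) (simp add: algebra_simps flip: power_mult power_add)
    \<comment> \<open>The geometric sum over \<open>u\<close> vanishes unless \<open>M\<close>
      divides \<open>k + i\<close>, which singles out \<open>i0\<close>.\<close>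
    also have "\<dots> = (\<Sum>i<M. if i = i0 then of_nat M * ?W ^ ((k + i) * v) else 0)"
    proof (rule sum.cong)
      fix i assume i: "i \<in> {..<M}"
      have "(?W ^ ((k + i) * r)) ^ M = 1"
        by (simp add: W_eq N_eq mult_ac flip: power_mult)
      then have "(\<Sum>u<M. (?W ^ ((k + i) * r)) ^ u) = (if M dvd k + i then of_nat M else 0)"
        using sum_powers_root_of_unity pos by (simp add: W_eq N_eq)
      then show "(\<Sum>u<M. ?W ^ ((k + i) * v) * (?W ^ ((k + i) * r)) ^ u) =
                 (if i = i0 then of_nat M * ?W ^ ((k + i) * v) else 0)"
        using dvd_add_iff_eq_complement[of i M k] i
        by (simp add: i0_def flip: sum_distrib_left)
    qed simp
    also have "\<dots> = of_nat M * (?W ^ M) ^ (t * v)"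
      using i0(1) by (simp add: t mult.assoc flip: power_mult)
    finally show "(\<Sum>u<M. K v * T (u * r + v)) = of_nat M * (K v * (?W ^ M) ^ (t * v))"
      by (simp add: mult.left_commute flip: sum_distrib_left)
  qed simp
  finally have "of_nat M * (of_nat r * (\<Sum>d\<in>D. \<psi> (\<gamma> ^ k * d))) =
                of_nat M * (\<Sum>v<r. K v * (?W ^ M) ^ (t * v))"
    by (simp add: N_eq sum_distrib_left mult.assoc)
  then have "of_nat r * (\<Sum>d\<in>D. \<psi> (\<gamma> ^ k * d)) = (\<Sum>v<r. K v * (?W ^ M) ^ (t * v))"
    using pos by simp
  \<comment> \<open>For such \<open>k\<close> the index \<open>i0\<close> is 0; hence every natural
    number occurs as a frequency.\<close>
  moreover have "t = s" if "k = M * s" for s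
    using that t pos by (simp add: i0_def)
  ultimately show ?thesis
    using that by blast
qed

end

end

end

section \<open>The criterion\<close>

theorem corollary4p2:
  fixes p1 m N p f q h h0 :: nat
    and \<gamma> :: "'a::{field,finite}"
    and D :: "'a set"
    and chi :: "'a \<Rightarrow> complex"
    and \<xi> :: complex
    and b c :: int
  assumes "prime p1" and "p1 > 3" and "[p1 = 3] (mod 4)"
    and "m \<ge> 1" and "N = p1 ^ m"
    and "prime p" and "coprime N p"
    and "f = ord N p" and "real f = real (totient N) / 2"
    and "q = p ^ f" and "CARD('a) = q"
    and "primitive_element \<gamma>"
    and "D = (\<Union>i \<in> {0..p1 ^ (m - 1) - 1}. cyclotomic_class \<gamma> N i)"
    and "primitive_root_of_unity p \<xi>"
    and "multiplicative_character chi"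
    and "chi \<gamma> = exp (2 * of_real pi * \<i> / of_nat N)"
    and "h = class_number (quadratic_field (- int p1))"
    and "real h0 = (real f - real h) / 2"
    and "gauss_sum \<xi> p f (\<lambda>x. inverse (chi x)) =
           (of_int b + of_int c * csqrt (- of_nat p1)) / 2 * of_nat p ^ h0"
    and "\<not> [b = 0] (mod int p)" and "\<not> [c = 0] (mod int p)"
    and "b\<^sup>2 + int p1 * c\<^sup>2 = 4 * int p ^ h"
    and "[b * int p ^ h0 = -2] (mod int p1)"
  shows "strongly_regular (cayley_graph D) \<longleftrightarrow> b \<in> {1, -1} \<and> c \<in> {1, -1}"
proof -
  have p1_gt_2: "p1 > 2" and p1_pos: "p1 > 0" "p1 > 1"
    using \<open>p1 > 3\<close> by auto
  define M where "M = p1 ^ (m - 1)"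
  have N_eq: "N = M * p1"
    using \<open>N = p1 ^ m\<close> \<open>m \<ge> 1\<close> power_minus_mult[of m p1] by (simp add: M_def)
  have M_pos: "M > 0"
    using p1_pos by (simp add: M_def)
  have "odd p1"
    using \<open>prime p1\<close> p1_gt_2 prime_odd_nat by blast
  then have "odd N"
    using \<open>N = p1 ^ m\<close> by simp
  then have "N > 0"
    by (rule odd_pos)
  have "p > 0"
    using \<open>prime p\<close> by (rule prime_gt_0_nat)
  have half: "2 * ord (p1 ^ m) p = totient (p1 ^ m)"
  proof -
    have "real (2 * f) = real (totient N)"
      using \<open>real f = real (totient N) / 2\<close> by simp
    then have "2 * f = totient N"
      by (simp only: of_nat_eq_iff)
    then show ?thesis
      using \<open>f = ord N p\<close> \<open>N = p1 ^ m\<close> by simp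
  qed
  have card: "CARD('a) = p ^ f"
    using \<open>CARD('a) = q\<close> \<open>q = p ^ f\<close> by simp
  have chi_root: "primitive_root_of_unity N (chi \<gamma>)"
    using primitive_root_of_unity_exp[OF \<open>N > 0\<close>] \<open>chi \<gamma> = _\<close> by simp
  note chars = \<open>primitive_element \<gamma>\<close> \<open>multiplicative_character chi\<close> chi_root

  define \<psi> :: "'a \<Rightarrow> complex" where "\<psi> = additive_character \<xi> p f"
  have psi: "\<psi> (x + y) = \<psi> x * \<psi> y" "norm (\<psi> x) = 1" "\<exists>x. \<psi> x \<noteq> 1" "\<psi> (x ^ p) = \<psi> x" for x y
    using additive_character_add norm_additive_character additive_character_nontrivial
      additive_character_frobenius \<open>prime p\<close> card \<open>primitive_root_of_unity p \<xi>\<close>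
    unfolding \<psi>_def by blast+
  have bij: "bij (\<lambda>x :: 'a. x ^ p)"
    using bij_frobenius \<open>prime p\<close> card \<open>primitive_root_of_unity p \<xi>\<close> by blast

  have "{0..M - 1} = {..<M}"
    using M_pos by auto
  then have D_eq: "D = {x. x \<noteq> 0 \<and> (\<exists>i<M. chi x = chi \<gamma> ^ i)}"
    using \<open>D = _\<close> cyclotomic_class_eq[OF chars] by (auto simp: M_def)

  define P :: complex where "P = of_nat p ^ h0"
  define s where "s = csqrt (- of_nat p1)"
  define lg :: "nat \<Rightarrow> complex" where "lg v = of_int (Legendre (int v) (int p1))" for v
  define G where "G = gauss_power_sum chi \<psi>"
  have "P / 2 \<noteq> 0"
    using \<open>p > 0\<close> by (simp add: P_def)
  have lg_mod: "lg (v mod p1) = lg v" for v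
    by (simp add: lg_def zmod_int Legendre_cong[of "int v mod int p1" "int v"] cong_def)
  have lg_cases: "lg v = 1 \<or> lg v = - 1" if "\<not> p1 dvd v" for v
    using that Legendre_range[of "int v" "int p1"] Legendre_eq_0_iff[of "int v" "int p1"]
    by (auto simp: lg_def)
  have lg_dvd: "lg v = 0" if "p1 dvd v" for v
    using that Legendre_eq_0_iff[of "int v" "int p1"] by (simp add: lg_def)

  have G_cong: "G j = G k" if "[j = k] (mod N)" for j k
    unfolding G_def using gauss_power_sum_cong[OF chars psi(1-3) that] .
  have G_cnj: "G j = cnj (G k)" if "[j + k = 0] (mod N)" for j k
    unfolding G_def using gauss_power_sum_cnj[OF chars psi(1-3) \<open>odd N\<close> that] .
  have G_power': "G (p ^ t) = G 1" for t
    unfolding G_def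
    using gauss_power_sum_frobenius[OF chars psi(1-3) psi(4) bij \<open>p > 0\<close>, of t 1] by simp
  have G_last: "G (N - 1) = (of_int b + of_int c * s) / 2 * P"
    unfolding G_def gauss_power_sum_inverse[OF chars psi(1-3), symmetric]
    using \<open>gauss_sum _ _ _ _ = _\<close> by (simp add: gauss_sum_def \<psi>_def s_def P_def)
  \<comment> \<open>The hypothesis gives the Gauss sum of the inverse character, of exponent
    \<open>N - 1\<close>. Passing to exponent 1 conjugates it and flips the sign of
    \<open>c\<close>.\<close>
  have "[1 + (N - 1) = 0] (mod N)"
    using \<open>N > 0\<close> by (simp add: cong_0_iff)
  then have "G 1 = cnj (G (N - 1))"
    by (rule G_cnj)
  moreover have cnj_s: "cnj s = - s"
    by (simp add: s_def)
  ultimately have G_power: "G (p ^ t) = (of_int b - of_int c * s) / 2 * P" for t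
    unfolding G_power' G_last by (simp add: P_def)
  have cnj_G_power: "cnj (G (p ^ t)) = (of_int b + of_int c * s) / 2 * P" for t
    unfolding G_power by (simp add: cnj_s P_def)

  \<comment> \<open>\<open>K 0\<close> is the Gauss sum of the trivial character. The minus sign
    occurs because symbol 1 belongs to \<open>G 1\<close>, the conjugate of the given sum.\<close>
  define K where
    "K v = (if v = 0 then - 1 else (of_int b - lg v * (of_int c * s)) / 2 * P)" for v
  have K: "G j = K (j mod p1)" if j: "\<not> p1 dvd j" for j
  proof -
    have K_eq: "K (j mod p1) = (of_int b - lg j * (of_int c * s)) / 2 * P"
      using j by (simp add: K_def lg_mod dvd_eq_mod_eq_0)
    have "coprime (p1 ^ m) p"
      using \<open>coprime N p\<close> \<open>N = p1 ^ m\<close> by simp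
    from unit_is_power_or_minus_power[OF \<open>prime p1\<close> p1_gt_2 \<open>[p1 = 3] (mod 4)\<close> \<open>m \<ge> 1\<close> this half j]
    show ?thesis
    proof (elim disjE conjE exE)
      fix t assume "Legendre (int j) (int p1) = 1" and "[j = p ^ t] (mod p1 ^ m)"
      then show ?thesis
        using G_cong[of j "p ^ t"] \<open>N = p1 ^ m\<close> by (simp add: K_eq lg_def G_power)
    next
      fix t assume "Legendre (int j) (int p1) = - 1" and "[j + p ^ t = 0] (mod p1 ^ m)"
      then show ?thesis
        using G_cnj[of j "p ^ t"] \<open>N = p1 ^ m\<close> by (simp add: K_eq lg_def cnj_G_power)
    qed
  qed

  define \<zeta> where "\<zeta> = inverse (chi \<gamma>) ^ M"
  have zeta_root: "primitive_root_of_unity p1 \<zeta>"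
    unfolding \<zeta>_def
    by (rule primitive_root_inverse_power[OF chars psi(1-3) N_eq D_eq])
  define \<tau> where "\<tau> = twisted_sum p1 \<zeta> 1"
  have s_square: "s\<^sup>2 = - of_nat p1"
    unfolding s_def by (rule power2_csqrt)
  have "\<tau>\<^sup>2 = s\<^sup>2"
    unfolding \<tau>_def s_square
    by (rule quadratic_gauss_sum_square[OF \<open>prime p1\<close> p1_gt_2 \<open>[p1 = 3] (mod 4)\<close> zeta_root])
  then have "\<tau> = s \<or> \<tau> = - s"
    by (simp add: power2_eq_iff)
  then have "s * \<tau> = 1 * of_nat p1 \<or> s * \<tau> = - 1 * of_nat p1"
    using s_square by (auto simp: power2_eq_square)
  \<comment> \<open>The sign of the quadratic Gauss sum is kept as an unknown \<epsilon>; the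
    condition \<open>b = c \<or> b = - c\<close> is symmetric under it.\<close>
  then obtain \<epsilon> :: complex where \<epsilon>: "\<epsilon> = 1 \<or> \<epsilon> = - 1" and s\<tau>: "s * \<tau> = \<epsilon> * of_nat p1"
    by blast

  \<comment> \<open>The correction term of \<open>sum_two_valued_weights\<close>, divided by
    \<open>p1\<close>; it shifts all values of \<open>X\<close> equally.\<close>
  define C where "C = (1 + of_int b * P / 2) / of_nat p1"
  define val where
    "val t = P / 2 * ((if p1 dvd t then of_int b else 0) - of_int c * \<epsilon> * lg t) - C" for t
  define X where "X a = (\<Sum>d\<in>D. \<psi> (a * d))" for a
  have X: "\<exists>t. X (\<gamma> ^ k) = val t \<and> (\<forall>n. k = M * n \<longrightarrow> t = n)" for k
  proof -
    obtain t where eq: "of_nat p1 * X (\<gamma> ^ k) = (\<Sum>v<p1. K v * \<zeta> ^ (t * v))"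
      and t: "\<And>n. k = M * n \<Longrightarrow> t = n"
      unfolding X_def \<zeta>_def
      by (rule character_sum_D[OF chars psi(1-3) N_eq D_eq K[unfolded G_def], of k]) (auto simp: K_def)
    have "of_nat p1 * X (\<gamma> ^ k) =
        P / 2 * ((if p1 dvd t then of_int b * of_nat p1 else 0) - of_int c * s * lg t * \<tau>)
          - (1 + of_int b * P / 2)"
      unfolding eq K_def lg_def \<tau>_def
      by (rule sum_two_valued_weights[OF \<open>prime p1\<close> p1_gt_2 \<open>[p1 = 3] (mod 4)\<close> zeta_root])
    also have "of_int c * s * lg t * \<tau> = of_int c * \<epsilon> * lg t * of_nat p1"
    proof -
      have "of_int c * s * lg t * \<tau> = of_int c * lg t * (s * \<tau>)"
        by (simp only: mult_ac)
      then show ?thesis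
        unfolding s\<tau> by (simp only: mult_ac)
    qed
    also have "P / 2 * ((if p1 dvd t then of_int b * of_nat p1 else 0)
          - of_int c * \<epsilon> * lg t * of_nat p1) - (1 + of_int b * P / 2) = of_nat p1 * val t"
      using p1_pos by (simp add: val_def C_def field_simps)
    finally have "X (\<gamma> ^ k) = val t"
      using p1_pos by simp
    then show ?thesis
      using t by blast
  qed

  have generator_nonzero: "\<gamma> ^ k \<noteq> 0" for k
    using \<open>primitive_element \<gamma>\<close> unfolding primitive_element_def by blast
  \<comment> \<open>The value \<open>val t\<close> is attained at \<open>\<gamma> ^ (M * t)\<close>,
    by the second property of the frequency.\<close>
  have range_X: "X ` (UNIV - {0}) = range val"
  proof (intro equalityI subsetI)
    fix z assume "z \<in> X ` (UNIV - {0})"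
    then obtain a where a: "a \<noteq> 0" "z = X a"
      by blast
    then obtain k where "a = \<gamma> ^ k"
      using \<open>primitive_element \<gamma>\<close> unfolding primitive_element_def by blast
    then have "z = X (\<gamma> ^ k)"
      using a by simp
    then show "z \<in> range val"
      using X[of k] by auto
  next
    fix z assume "z \<in> range val"
    then obtain t where "z = val t"
      by blast
    then have "z = X (\<gamma> ^ (M * t))"
      using X[of "M * t"] by auto
    then show "z \<in> X ` (UNIV - {0})"
      using generator_nonzero by simp
  qed

  have "c \<noteq> 0"
    using \<open>\<not> [c = 0] (mod int p)\<close> by auto
  have two_values: "(\<exists>r s. range val \<subseteq> {r, s}) \<longleftrightarrow> b = c \<or> b = - c"
  proof
    assume "\<exists>r s. range val \<subseteq> {r, s}"
    then obtain y z where "range val \<subseteq> {y, z}"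
      by (elim exE)
    then have yz: "val t \<in> {y, z}" for t
      by (simp only: image_subset_iff UNIV_I simp_thms ball_simps)
    \<comment> \<open>The arguments 0, 1 and \<open>p1 - 1\<close> represent multiples of
      \<open>p1\<close>, residues and nonresidues.\<close>
    have "int (p1 - 1) = int p1 - 1"
      using p1_pos by simp
    then have "Legendre (int (p1 - 1)) (int p1) = Legendre (- 1) (int p1)"
      by (intro Legendre_cong) (simp add: cong_iff_dvd_diff)
    then have "lg (p1 - 1) = - 1"
      using Legendre_uminus[OF \<open>prime p1\<close> p1_gt_2 \<open>[p1 = 3] (mod 4)\<close>, of 1] Legendre_1[OF p1_gt_2]
      by (simp add: lg_def)
    moreover have "\<not> p1 dvd p1 - 1"
      using p1_gt_2 by (auto dest: dvd_imp_le)
    ultimately have v2: "val (p1 - 1) = P / 2 * (of_int c * \<epsilon>) - C"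
      by (simp add: val_def)
    have v1: "val 1 = - (P / 2 * (of_int c * \<epsilon>)) - C"
      using p1_gt_2 Legendre_1[OF p1_gt_2] by (simp add: val_def lg_def)
    have v0: "val 0 = P / 2 * of_int b - C"
      using lg_dvd[of 0] by (simp add: val_def)
    have "P / 2 * (of_int c * \<epsilon>) \<noteq> 0"
      using \<open>P / 2 \<noteq> 0\<close> \<open>c \<noteq> 0\<close> \<epsilon> by auto
    then have "val 1 \<noteq> val (p1 - 1)"
      unfolding v1 v2 by (simp add: eq_neg_iff_add_eq_0 flip: mult_2)
    \<comment> \<open>Since \<open>c\<close> is nonzero, the residue and nonresidue values differ
      and already use up both \<open>y\<close> and \<open>z\<close>.\<close>
    then have "val 0 = val 1 \<or> val 0 = val (p1 - 1)"
      using yz[of 0] yz[of 1] yz[of "p1 - 1"] by auto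
    then have "P / 2 * of_int b = P / 2 * (of_int (- c) * \<epsilon>) \<or> P / 2 * of_int b = P / 2 * (of_int c * \<epsilon>)"
      unfolding v0 v1 v2 by auto
    then have "(of_int b :: complex) = of_int (- c) * \<epsilon> \<or> (of_int b :: complex) = of_int c * \<epsilon>"
      unfolding mult_left_cancel[OF \<open>P / 2 \<noteq> 0\<close>] .
    then have "(of_int b :: complex) = of_int c \<or> (of_int b :: complex) = of_int (- c)"
      using \<epsilon> by auto
    then show "b = c \<or> b = - c"
      by (simp only: of_int_eq_iff)
  next
    assume bc: "b = c \<or> b = - c"
    \<comment> \<open>When \<open>b\<close> is \<open>c\<close> or \<open>- c\<close>, the residue
      and nonresidue values are these two in some order, and multiples of \<open>p1\<close> give the
      first.\<close>
    have "val t \<in> {P / 2 * of_int b - C, - (P / 2 * of_int b) - C}" for t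
    proof (cases "p1 dvd t")
      case True
      then show ?thesis
        by (simp add: val_def lg_dvd)
    next
      case False
      then show ?thesis
        using lg_cases[OF False] bc \<epsilon> by (auto simp: val_def)
    qed
    then have "range val \<subseteq> {P / 2 * of_int b - C, - (P / 2 * of_int b) - C}"
      by (rule image_subsetI)
    then show "\<exists>r s. range val \<subseteq> {r, s}"
      by (intro exI)
  qed

  have "strongly_regular (cayley_graph D) \<longleftrightarrow> (\<exists>r s. \<forall>a. a \<noteq> 0 \<longrightarrow> X a \<in> {r, s})"
    unfolding X_def
  proof (rule strongly_regular_cayley_graph_iff[OF psi(1-3)])
    show "- x \<in> D" if "x \<in> D" for x
      using D_uminus[OF chars psi(1-3) N_eq D_eq \<open>odd N\<close> that] .
    show "0 \<notin> D"
      by (simp add: D_eq)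
    show "D \<noteq> {}"
      using one_in_D[OF chars psi(1-3) N_eq D_eq] by blast
    show "\<exists>x. x \<noteq> 0 \<and> x \<notin> D"
      using generator_power_notin_D[OF chars psi(1-3) N_eq D_eq p1_pos(2)] generator_nonzero[of M]
      by blast
  qed
  also have "\<dots> \<longleftrightarrow> (\<exists>r s. X ` (UNIV - {0}) \<subseteq> {r, s})"
    by (simp add: image_subset_iff Ball_def)
  also have "\<dots> \<longleftrightarrow> b = c \<or> b = - c"
    unfolding range_X by (rule two_values)
  \<comment> \<open>Forwards this is the norm equation; backwards, two signs are equal or
    opposite.\<close>
  also have "\<dots> \<longleftrightarrow> b \<in> {1, - 1} \<and> c \<in> {1, - 1}"
    using unit_coeffs_of_norm_equation[OF \<open>prime p\<close> \<open>[p1 = 3] (mod 4)\<close> \<open>\<not> [b = 0] (mod int p)\<close>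
        \<open>b\<^sup>2 + int p1 * c\<^sup>2 = 4 * int p ^ h\<close>] by auto
  finally show ?thesis .
qed

end
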